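(* Let $P\in\mathbb{C}[x,y_0,\ldots,y_n]$ with $P\neq0$, and let $s(x)\in\Omega$ be a solution of $P=0$ (i.e. $P(x,s(x),s'(x),\ldots,s^{(n)}(x))=0$) whose support has maximal rational rank, that is \[ \dim_{\mathbb{Q}}\frac{\langle\operatorname{supp}s(x)\cup\operatorname{supp}P\rangle}{\langle\operatorname{supp}P\rangle}=n . \] Then $s(x)$ converges uniformly in any sector $S$ of sufficiently small radius with vertex at the origin and of opening less than $2\pi$.
   Context: $\Omega$ denotes the field of generalized power series $s(x)=\sum_{i\ge1}c_i x^{\mu_i}$ with $c_i\in\mathbb{C}$, $\mu_i\in\mathbb{R}$, $\mu_1<\mu_2<\cdots$ and $\mu_i\to\infty$ when there are infinitely many terms; $\operatorname{supp}s=\{\mu_i:c_i\ne0\}$. For $P\in\mathbb{C}[x,y_0,\ldots,y_n]$, viewed as a polynomial in $y_0,\ldots,y_n$ with coefficients in $\mathbb{C}[x]\subset\Omega$, $\operatorname{supp}P$ is the union of the supports of these coefficients (so $\langle\operatorname{supp}P\rangle$ is $\{0\}$ or $\mathbb{Q}$). For $E\subset\mathbb{R}$, $\langle E\rangle$ is the $\mathbb{Q}$-linear span of $E$. The operator $'$ is one fixed choice among: (a) ordinary derivative $\frac{d}{dx}$; (b) Euler derivative $x\frac{d}{dx}$; (c) $q$-difference operator $s'(x)=s(qx)$, i.e. $\sum c_ix^{\mu_i}\mapsto\sum c_iq^{\mu_i}x^{\mu_i}$, for fixed $q\in\mathbb{C}$, $|q|\ne1$. $s^{(\kappa)}$ is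 the $\kappa$-th iterate of $'$. *)

theory Defs
  imports "HOL-Analysis.Analysis" "HOL-Computational_Algebra.Polynomial"
begin

text \<open>Generalized power series: coefficient functions real => complex such that
  below every bound only finitely many exponents carry nonzero coefficients
  (equivalently: exponents mu_1 < mu_2 < ... tending to infinity if infinite).\<close>
type_synonym gser = "real \<Rightarrow> complex"

definition is_gser :: "gser \<Rightarrow> bool" where
  "is_gser s \<longleftrightarrow> (\<forall>t. finite {\<mu>. \<mu> \<le> t \<and> s \<mu> \<noteq> 0})"

definition gsupp :: "gser \<Rightarrow> real set" where
  "gsupp s = {\<mu>. s \<mu> \<noteq> 0}"

definition gadd :: "gser \<Rightarrow> gser \<Rightarrow> gser" where
  "gadd a b = (\<lambda>t. a t + b t)"

definition gmult :: "gser \<Rightarrow> gser \<Rightarrow> gser" where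
  "gmult a b = (\<lambda>t. \<Sum>u\<in>{u. a u \<noteq> 0 \<and> b (t - u) \<noteq> 0}. a u * b (t - u))"

definition gone :: gser where
  "gone = (\<lambda>t. if t = 0 then 1 else 0)"

definition gzero :: gser where
  "gzero = (\<lambda>t. 0)"

definition gpow :: "gser \<Rightarrow> nat \<Rightarrow> gser" where
  "gpow s k = (gmult s ^^ k) gone"

definition gprod_list :: "gser list \<Rightarrow> gser" where
  "gprod_list xs = foldr gmult xs gone"

definition poly_gser :: "complex poly \<Rightarrow> gser" where
  "poly_gser p = (\<lambda>t. if t = of_nat (nat \<lfloor>t\<rfloor>) then coeff p (nat \<lfloor>t\<rfloor>) else 0)"

datatype oper = Deriv | Euler | QDiff complex

definition valid_oper :: "oper \<Rightarrow> bool" where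
  "valid_oper D = (case D of QDiff q \<Rightarrow> q \<noteq> 0 \<and> cmod q \<noteq> 1 | _ \<Rightarrow> True)"

fun apply_oper :: "oper \<Rightarrow> gser \<Rightarrow> gser" where
  "apply_oper Deriv s = (\<lambda>t. of_real (t + 1) * s (t + 1))"
| "apply_oper Euler s = (\<lambda>t. of_real t * s t)"
| "apply_oper (QDiff q) s = (\<lambda>t. (q powr of_real t) * s t)"

text \<open>Differential(-difference) polynomial P in C[x,y_0,...,y_n]: a finitely supported
  map from exponent vectors (lists of length n+1) to coefficients in C[x].\<close>
definition is_dpoly :: "nat \<Rightarrow> (nat list \<Rightarrow> complex poly) \<Rightarrow> bool" where
  "is_dpoly n P \<longleftrightarrow> finite {\<alpha>. P \<alpha> \<noteq> 0} \<and> (\<forall>\<alpha>. P \<alpha> \<noteq> 0 \<longrightarrow> length \<alpha> = Suc n)"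

definition eval_dpoly :: "oper \<Rightarrow> nat \<Rightarrow> (nat list \<Rightarrow> complex poly) \<Rightarrow> gser \<Rightarrow> gser" where
  "eval_dpoly D n P s =
     (\<lambda>t. \<Sum>\<alpha>\<in>{\<alpha>. P \<alpha> \<noteq> 0}.
        gmult (poly_gser (P \<alpha>))
          (gprod_list (map (\<lambda>i. gpow ((apply_oper D ^^ i) s) (\<alpha> ! i)) [0..<Suc n])) t)"

definition dpoly_supp :: "(nat list \<Rightarrow> complex poly) \<Rightarrow> real set" where
  "dpoly_supp P = (\<Union>\<alpha>. {real k | k. coeff (P \<alpha>) k \<noteq> 0})"

definition rat_span :: "real set \<Rightarrow> real set" where
  "rat_span E = {\<Sum>e\<in>F. of_rat (c e) * e | F c. finite F \<and> F \<subseteq> E}"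

definition indep_mod :: "real set \<Rightarrow> real set \<Rightarrow> bool" where
  "indep_mod W B \<longleftrightarrow> (\<forall>c. (\<Sum>b\<in>B. of_rat (c b) * b) \<in> W \<longrightarrow> (\<forall>b\<in>B. c b = 0))"

text \<open>dim_Q (span E / span W) = n, for W \<subseteq> E.\<close>
definition quot_rank_eq :: "real set \<Rightarrow> real set \<Rightarrow> nat \<Rightarrow> bool" where
  "quot_rank_eq E W n \<longleftrightarrow>
     (\<exists>B. B \<subseteq> E \<and> finite B \<and> card B = n \<and> indep_mod (rat_span W) B) \<and>
     (\<forall>B. B \<subseteq> E \<and> finite B \<and> indep_mod (rat_span W) B \<longrightarrow> card B \<le> n)"

text \<open>Partial sums (terms with exponent \<le> t) evaluated at x = r e^{i theta},
  using the branch x^mu = r^mu e^{i mu theta}.\<close>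
definition gpartial :: "gser \<Rightarrow> real \<Rightarrow> real \<times> real \<Rightarrow> complex" where
  "gpartial s t = (\<lambda>(r, \<theta>). \<Sum>\<mu>\<in>{\<mu>. \<mu> \<le> t \<and> s \<mu> \<noteq> 0}.
       s \<mu> * of_real (r powr \<mu>) * cis (\<mu> * \<theta>))"

definition sector :: "real \<Rightarrow> real \<Rightarrow> real \<Rightarrow> (real \<times> real) set" where
  "sector \<rho> \<theta>0 \<beta> = {0<..<\<rho>} \<times> {\<theta>0<..<\<theta>0 + \<beta>}"

end

theory Submission
  imports Defs
begin

text \<open>The support having maximal rational rank provides \<open>n\<close> rational functionals \<open>l\<close> that vanish on
  \<open>\<langle>supp P\<rangle>\<close>. Each gives a derivation \<open>x\<^sup>\<mu> \<mapsto> l(\<mu>) x\<^sup>\<mu>\<close> of the series ring that annihilates the coefficients of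
  \<open>P\<close> and commutes with the operator, hence a solution of the equation linearized along \<open>s\<close>.
  Choosing the functionals along the exponents at which the span of the initial support jumps makes the
  leading exponents of these solutions distinct, so the indicial polynomial of the linearization has \<open>n\<close>
  roots. It therefore has full degree: the linearized equation is regular singular.
  After splitting off a long initial part of \<open>s\<close>, the remaining coefficients obey a recursion
  without small divisors, and bounding it by its own truncations gives absolute convergence for a small radius.\<close>

section \<open>The ring of generalized power series\<close>

text \<open>The linearization of \<open>P\<close> along \<open>s\<close> may vanish identically.
  \<open>P\<close> is therefore traded for some \<open>P'\<close> that still vanishes at
  \<open>s\<close> but has a partial derivative nonzero there; the exponents of its coefficients
  stay among those of \<open>P\<close>, so functionals that kill \<open>dpoly_supp P\<close> still
  annihilate the coefficients of \<open>P'\<close>.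

  The three operators can be treated together because the i-th iterate is always a shift of
  exponents composed with a diagonal operator, whose symbol is a polynomial of exact degree i in an
  injective function of the exponent mu: mu itself, or q^mu, where |q| different from 1 gives
  injectivity. This is why counting roots decides the degree of the indicial polynomial, and why
  full degree means that it eventually dominates every symbol of index up to n. That domination is
  the absence of small divisors.

  The main obstacle is d/dx: it shifts exponents by integers, so a derivation coming from a
  functional commutes with it only if the functional kills 1, even when \<open>P\<close> has
  constant coefficients.\<close>

lemma gser_lower_bound:
  assumes "is_gser a"
  obtains L where "\<And>\<mu>. a \<mu> \<noteq> 0 \<Longrightarrow> L \<le> \<mu>"
proof -
  let ?S = "{\<mu>. \<mu> \<le> 0 \<and> a \<mu> \<noteq> 0}"
  have fin: "finite ?S" using assms by (simp add: is_gser_def)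
  have "Min (insert 0 ?S) \<le> \<mu>" if "a \<mu> \<noteq> 0" for \<mu>
  proof (cases "\<mu> \<le> 0")
    case True
    then show ?thesis using that fin by (intro Min_le) auto
  next
    case False
    have "Min (insert 0 ?S) \<le> 0" using fin by (intro Min_le) auto
    then show ?thesis using False by linarith
  qed
  then show ?thesis using that by blast
qed

lemma gser_finite: "is_gser a \<Longrightarrow> finite {\<mu>. \<mu> \<le> t \<and> a \<mu> \<noteq> 0}"
  by (simp add: is_gser_def)

lemma finite_conv_support:
  assumes "is_gser a" "is_gser b"
  shows "finite {u. a u \<noteq> 0 \<and> b (t - u) \<noteq> 0}"
proof -
  obtain L where L: "\<And>\<mu>. b \<mu> \<noteq> 0 \<Longrightarrow> L \<le> \<mu>" using gser_lower_bound assms(2) by blast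
  have "{u. a u \<noteq> 0 \<and> b (t - u) \<noteq> 0} \<subseteq> {u. u \<le> t - L \<and> a u \<noteq> 0}"
    using L by force
  then show ?thesis using gser_finite[OF assms(1)] finite_subset by blast
qed

text \<open>Exact supports vary from product to product; a common finite superset as index set lets
  several convolutions be compared termwise.\<close>

lemma gmult_eq_sum:
  assumes "finite U" "\<And>u. a u \<noteq> 0 \<Longrightarrow> b (t - u) \<noteq> 0 \<Longrightarrow> u \<in> U"
  shows "gmult a b t = (\<Sum>u\<in>U. a u * b (t - u))"
  unfolding gmult_def using assms by (intro sum.mono_neutral_left) auto

lemma gmult_commute: "gmult a b = gmult b a"
proof
  fix t
  show "gmult a b t = gmult b a t"
    unfolding gmult_def
    by (rule sum.reindex_bij_witness[of _ "\<lambda>u. t - u" "\<lambda>u. t - u"]) (auto simp: mult.commute)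
qed

lemma gmult_nonzeroD:
  assumes "gmult a b t \<noteq> 0"
  obtains u where "a u \<noteq> 0" "b (t - u) \<noteq> 0"
proof -
  from assms have "{u. a u \<noteq> 0 \<and> b (t - u) \<noteq> 0} \<noteq> {}" unfolding gmult_def by (metis sum.empty)
  then show ?thesis using that by blast
qed

lemma is_gser_gmult:
  assumes "is_gser a" "is_gser b"
  shows "is_gser (gmult a b)"
  unfolding is_gser_def
proof
  fix t
  obtain La where La: "\<And>\<mu>. a \<mu> \<noteq> 0 \<Longrightarrow> La \<le> \<mu>" using gser_lower_bound assms(1) by blast
  obtain Lb where Lb: "\<And>\<mu>. b \<mu> \<noteq> 0 \<Longrightarrow> Lb \<le> \<mu>" using gser_lower_bound assms(2) by blast
  have "{\<mu>. \<mu> \<le> t \<and> gmult a b \<mu> \<noteq> 0} \<subseteq>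
      (\<lambda>(u, v). u + v) ` ({\<mu>. \<mu> \<le> t - Lb \<and> a \<mu> \<noteq> 0} \<times> {\<mu>. \<mu> \<le> t - La \<and> b \<mu> \<noteq> 0})"
  proof
    fix \<mu> assume \<mu>: "\<mu> \<in> {\<mu>. \<mu> \<le> t \<and> gmult a b \<mu> \<noteq> 0}"
    then obtain u where u: "a u \<noteq> 0" "b (\<mu> - u) \<noteq> 0" using gmult_nonzeroD by blast
    then show "\<mu> \<in> (\<lambda>(u, v). u + v) ` ({\<mu>. \<mu> \<le> t - Lb \<and> a \<mu> \<noteq> 0} \<times> {\<mu>. \<mu> \<le> t - La \<and> b \<mu> \<noteq> 0})"
      using La[OF u(1)] Lb[OF u(2)] \<mu> by (intro image_eqI[of _ _ "(u, \<mu> - u)"]) auto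
  qed
  then show "finite {\<mu>. \<mu> \<le> t \<and> gmult a b \<mu> \<noteq> 0}"
    using gser_finite[OF assms(1)] gser_finite[OF assms(2)] finite_subset by blast
qed

lemma gmult_assoc:
  assumes "is_gser a" "is_gser b" "is_gser c"
  shows "gmult (gmult a b) c = gmult a (gmult b c)"
proof
  fix t
  obtain La where La: "\<And>\<mu>. a \<mu> \<noteq> 0 \<Longrightarrow> La \<le> \<mu>" using gser_lower_bound assms(1) by blast
  obtain Lb where Lb: "\<And>\<mu>. b \<mu> \<noteq> 0 \<Longrightarrow> Lb \<le> \<mu>" using gser_lower_bound assms(2) by blast
  obtain Lc where Lc: "\<And>\<mu>. c \<mu> \<noteq> 0 \<Longrightarrow> Lc \<le> \<mu>" using gser_lower_bound assms(3) by blast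
  have Lab: "La + Lb \<le> \<mu>" if "gmult a b \<mu> \<noteq> 0" for \<mu>
    using that by (rule gmult_nonzeroD) (use La Lb in force)
  have Lbc: "Lb + Lc \<le> \<mu>" if "gmult b c \<mu> \<noteq> 0" for \<mu>
    using that by (rule gmult_nonzeroD) (use Lb Lc in force)
  \<comment> \<open>Finite index sets for the two outer factors that do not depend on the inner
    variables: in a nonzero term with exponents adding up to \<open>t\<close>, the lower bounds of
    the other two factors bound the third from above. Associativity becomes an exchange of finite
    sums.\<close>
  define U where "U = {u. u \<le> t - Lb - Lc \<and> a u \<noteq> 0}"
  define W where "W = {w. w \<le> t - La - Lb \<and> c w \<noteq> 0}"
  have fU: "finite U" and fW: "finite W" unfolding U_def W_def using assms gser_finite by auto
  have "gmult (gmult a b) c t = (\<Sum>w\<in>W. c w * gmult a b (t - w))"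
    unfolding gmult_commute[of "gmult a b"]
    by (rule gmult_eq_sum[OF fW]) (use Lab in \<open>force simp: W_def\<close>)
  also have "\<dots> = (\<Sum>w\<in>W. c w * (\<Sum>u\<in>U. a u * b (t - w - u)))"
  proof (intro sum.cong refl arg_cong2[of _ _ _ _ "(*)"] gmult_eq_sum[OF fU])
    fix w u assume "w \<in> W" "a u \<noteq> 0" "b (t - w - u) \<noteq> 0"
    then show "u \<in> U" using Lb[of "t - w - u"] Lc[of w] by (auto simp: U_def W_def)
  qed
  also have "\<dots> = (\<Sum>w\<in>W. \<Sum>u\<in>U. a u * (c w * b (t - u - w)))"
    by (simp add: sum_distrib_left algebra_simps)
  also have "\<dots> = (\<Sum>u\<in>U. \<Sum>w\<in>W. a u * (c w * b (t - u - w)))"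
    by (rule sum.swap)
  also have "\<dots> = (\<Sum>u\<in>U. a u * (\<Sum>w\<in>W. c w * b (t - u - w)))"
    by (simp add: sum_distrib_left)
  also have "\<dots> = (\<Sum>u\<in>U. a u * gmult c b (t - u))"
  proof (intro sum.cong refl arg_cong2[of _ _ _ _ "(*)"] gmult_eq_sum[OF fW, symmetric])
    fix w u assume "u \<in> U" "c w \<noteq> 0" "b (t - u - w) \<noteq> 0"
    then show "w \<in> W" using Lb[of "t - u - w"] La[of u] by (auto simp: U_def W_def)
  qed
  also have "\<dots> = gmult a (gmult b c) t"
    unfolding gmult_commute[of c b]
    by (rule gmult_eq_sum[OF fU, symmetric]) (use Lbc in \<open>force simp: U_def\<close>)
  finally show "gmult (gmult a b) c t = gmult a (gmult b c) t" .
qed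

lemma is_gser_finite: "finite {\<mu>. a \<mu> \<noteq> 0} \<Longrightarrow> is_gser a"
  unfolding is_gser_def by (auto elim: rev_finite_subset)

text \<open>Packing the finiteness condition into a type gives a \<open>comm_ring_1\<close>
  instance, so ring normalization and finite sums and products apply without side conditions on
  supports.\<close>

typedef gs = "{s. is_gser s}"
  morphisms gcoeff Gs
  by (rule exI[of _ gzero]) (simp add: is_gser_def gzero_def)

setup_lifting type_definition_gs

lemma gs_eqI: "(\<And>t. gcoeff a t = gcoeff b t) \<Longrightarrow> a = b"
  by (metis ext gcoeff_inject)

lemma is_gser_gcoeff [simp]: "is_gser (gcoeff a)"
  using gcoeff by simp

instantiation gs :: comm_ring_1
begin

lift_definition zero_gs :: gs is gzero by (simp add: is_gser_def gzero_def)
lift_definition one_gs :: gs is gone by (rule is_gser_finite) (simp add: gone_def)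
lift_definition plus_gs :: "gs \<Rightarrow> gs \<Rightarrow> gs" is gadd
proof -
  fix a b assume ab: "is_gser a" "is_gser b"
  have "{\<mu>. \<mu> \<le> t \<and> gadd a b \<mu> \<noteq> 0} \<subseteq> {\<mu>. \<mu> \<le> t \<and> a \<mu> \<noteq> 0} \<union> {\<mu>. \<mu> \<le> t \<and> b \<mu> \<noteq> 0}" for t
    by (auto simp: gadd_def)
  then show "is_gser (gadd a b)"
    unfolding is_gser_def using ab gser_finite by (meson finite_Un finite_subset)
qed
lift_definition uminus_gs :: "gs \<Rightarrow> gs" is "\<lambda>a t. - a t" by (simp add: is_gser_def)
lift_definition minus_gs :: "gs \<Rightarrow> gs \<Rightarrow> gs" is "\<lambda>a b t. a t - b t"
proof -
  fix a b :: gser assume ab: "is_gser a" "is_gser b"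
  have "{\<mu>. \<mu> \<le> t \<and> a \<mu> - b \<mu> \<noteq> 0} \<subseteq> {\<mu>. \<mu> \<le> t \<and> a \<mu> \<noteq> 0} \<union> {\<mu>. \<mu> \<le> t \<and> b \<mu> \<noteq> 0}" for t
    by auto
  then show "is_gser (\<lambda>t. a t - b t)"
    unfolding is_gser_def using ab gser_finite by (meson finite_Un finite_subset)
qed
lift_definition times_gs :: "gs \<Rightarrow> gs \<Rightarrow> gs" is gmult by (rule is_gser_gmult)

lemma gmult_gone: "gmult gone a = a"
proof
  fix t show "gmult gone a t = a t"
    by (subst gmult_eq_sum[where U = "{0}"]) (auto simp: gone_def split: if_splits)
qed

instance
proof
  fix a b c :: gs
  show "a * b * c = a * (b * c)" by transfer (rule gmult_assoc)
  show "a * b = b * a" by transfer (rule gmult_commute)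
  show "1 * a = a" by transfer (rule gmult_gone)
  show "(0::gs) \<noteq> 1" by transfer (auto simp: gzero_def gone_def fun_eq_iff)
  show "(a + b) * c = a * c + b * c"
  proof (rule gs_eqI)
    fix t
    define U where "U = {u. gcoeff a u \<noteq> 0 \<and> gcoeff c (t - u) \<noteq> 0} \<union>
        {u. gcoeff b u \<noteq> 0 \<and> gcoeff c (t - u) \<noteq> 0}"
    have U: "finite U" by (simp add: U_def finite_conv_support)
    have "gmult (gadd (gcoeff a) (gcoeff b)) (gcoeff c) t =
        gmult (gcoeff a) (gcoeff c) t + gmult (gcoeff b) (gcoeff c) t"
      by (subst (1 2 3) gmult_eq_sum[OF U]) (auto simp: U_def gadd_def distrib_right sum.distrib)
    then show "gcoeff ((a + b) * c) t = gcoeff (a * c + b * c) t"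
      by (simp add: times_gs.rep_eq plus_gs.rep_eq) (simp add: gadd_def)
  qed
qed (transfer; simp add: gadd_def gzero_def fun_eq_iff)+

end

lemma gcoeff_0 [simp]: "gcoeff 0 t = 0"
  by transfer (simp add: gzero_def)

lemma gcoeff_1: "gcoeff 1 t = (if t = 0 then 1 else 0)"
  by transfer (simp add: gone_def)

lemma gcoeff_add [simp]: "gcoeff (a + b) t = gcoeff a t + gcoeff b t"
  by transfer (simp add: gadd_def)

lemma gcoeff_minus [simp]: "gcoeff (- a) t = - gcoeff a t"
  by transfer simp

lemma gcoeff_diff [simp]: "gcoeff (a - b) t = gcoeff a t - gcoeff b t"
  by transfer simp

lemma gcoeff_sum [simp]: "gcoeff (\<Sum>i\<in>A. f i) t = (\<Sum>i\<in>A. gcoeff (f i) t)"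
  by (induction A rule: infinite_finite_induct) auto

lemma gcoeff_sum_list: "gcoeff (sum_list xs) t = sum_list (map (\<lambda>a. gcoeff a t) xs)"
  by (induction xs) auto

lemma gcoeff_mult:
  assumes "finite U" "\<And>u. gcoeff a u \<noteq> 0 \<Longrightarrow> gcoeff b (t - u) \<noteq> 0 \<Longrightarrow> u \<in> U"
  shows "gcoeff (a * b) t = (\<Sum>u\<in>U. gcoeff a u * gcoeff b (t - u))"
  using gmult_eq_sum[OF assms] by (simp add: times_gs.rep_eq)

lemma gcoeff_mult_nonzeroD:
  assumes "gcoeff (a * b) t \<noteq> 0"
  obtains u where "gcoeff a u \<noteq> 0" "gcoeff b (t - u) \<noteq> 0"
  using assms gmult_nonzeroD unfolding times_gs.rep_eq by blast

lemma finite_gcoeff: "finite {\<mu>. \<mu> \<le> t \<and> gcoeff a \<mu> \<noteq> 0}"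
  by (simp add: gser_finite)

section \<open>Monomials, diagonal operators, lower bounds on exponents, finite support\<close>

lift_definition mon :: "real \<Rightarrow> gs" is "\<lambda>r t. if t = r then 1 else 0"
  by (rule is_gser_finite) simp

text \<open>One construction for the symbols of the operators, the truncations
  \<open>trunc_le\<close> and \<open>trunc_gt\<close>, and the derivations attached to rational
  functionals.\<close>

lift_definition diag :: "(real \<Rightarrow> complex) \<Rightarrow> gs \<Rightarrow> gs" is "\<lambda>f a t. f t * a t"
proof -
  fix f and a :: gser assume "is_gser a"
  moreover have "{\<mu>. \<mu> \<le> t \<and> f \<mu> * a \<mu> \<noteq> 0} \<subseteq> {\<mu>. \<mu> \<le> t \<and> a \<mu> \<noteq> 0}" for t by auto
  ultimately show "is_gser (\<lambda>t. f t * a t)"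
    unfolding is_gser_def by (meson finite_subset)
qed

lemma gcoeff_mon: "gcoeff (mon r) t = (if t = r then 1 else 0)"
  by transfer simp

lemma gcoeff_diag [simp]: "gcoeff (diag f a) t = f t * gcoeff a t"
  by transfer simp

lemma gcoeff_mon_mult [simp]: "gcoeff (mon r * a) t = gcoeff a (t - r)"
  by (subst gcoeff_mult[where U = "{r}"]) (auto simp: gcoeff_mon split: if_splits)

lemma mon_0: "mon 0 = 1"
  by (rule gs_eqI) (simp add: gcoeff_mon gcoeff_1)

lemma mon_mult: "mon r * mon r' = mon (r + r')"
  by (rule gs_eqI) (auto simp: gcoeff_mon)

lemma mon_mult_assoc: "mon r * (mon r' * a) = mon (r + r') * a"
  by (simp add: mon_mult mult.assoc [symmetric])

lemma diag_add: "diag f (a + b) = diag f a + diag f b"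
  by (rule gs_eqI) (simp add: algebra_simps)

lemma diag_mon: "diag f (mon r * a) = mon r * diag (\<lambda>t. f (t + r)) a"
  by (rule gs_eqI) simp

text \<open>Additivity splits \<open>f t\<close> over every pair of exponents with sum
  \<open>t\<close>, so each additive \<open>f\<close> gives a derivation.\<close>

lemma diag_mult:
  assumes "\<And>u v. f (u + v) = f u + f v"
  shows "diag f (a * b) = diag f a * b + a * diag f b"
proof (rule gs_eqI)
  fix t
  define U where "U = {u. gcoeff a u \<noteq> 0 \<and> gcoeff b (t - u) \<noteq> 0}"
  have U: "finite U" by (simp add: U_def finite_conv_support)
  have "f t = f u + f (t - u)" for u using assms[of u "t - u"] by simp
  then have "f t * (gcoeff a u * gcoeff b (t - u)) =
      f u * gcoeff a u * gcoeff b (t - u) + gcoeff a u * (f (t - u) * gcoeff b (t - u))" for u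
    by (metis distrib_right mult.assoc mult.left_commute)
  then show "gcoeff (diag f (a * b)) t = gcoeff (diag f a * b + a * diag f b) t"
    by (simp, subst (1 2 3) gcoeff_mult[OF U]) (auto simp: U_def sum_distrib_left sum.distrib[symmetric])
qed

text \<open>A bound instead of the exact order: it holds for \<open>0\<close> with every
  \<open>K\<close>, and it adds up under products without any nonvanishing condition.\<close>

definition lowb :: "real \<Rightarrow> gs \<Rightarrow> bool" where
  "lowb K a \<longleftrightarrow> (\<forall>t. gcoeff a t \<noteq> 0 \<longrightarrow> K \<le> t)"

lemma lowbD: "lowb K a \<Longrightarrow> t < K \<Longrightarrow> gcoeff a t = 0"
  unfolding lowb_def by force

lemma lowb_exists: "\<exists>K. lowb K a"
  using gser_lower_bound[OF is_gser_gcoeff, of a] unfolding lowb_def by metis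

lemma lowb_mono: "lowb K a \<Longrightarrow> L \<le> K \<Longrightarrow> lowb L a"
  unfolding lowb_def by force

lemma lowb_0 [simp]: "lowb K 0"
  by (simp add: lowb_def)

lemma lowb_1: "lowb 0 1"
  by (simp add: lowb_def gcoeff_1)

lemma lowb_add: "lowb K a \<Longrightarrow> lowb K b \<Longrightarrow> lowb K (a + b)"
  unfolding lowb_def by (metis add.right_neutral gcoeff_add)

lemma lowb_uminus: "lowb K a \<Longrightarrow> lowb K (- a)"
  unfolding lowb_def by simp

lemma lowb_sum_list: "(\<And>a. a \<in> set xs \<Longrightarrow> lowb K a) \<Longrightarrow> lowb K (sum_list xs)"
  by (induction xs) (auto intro: lowb_add)

lemma lowb_mult: "lowb K a \<Longrightarrow> lowb L b \<Longrightarrow> lowb (K + L) (a * b)"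
  unfolding lowb_def
proof (intro allI impI)
  fix t assume *: "\<forall>t. gcoeff a t \<noteq> 0 \<longrightarrow> K \<le> t" "\<forall>t. gcoeff b t \<noteq> 0 \<longrightarrow> L \<le> t" "gcoeff (a * b) t \<noteq> 0"
  obtain u where "gcoeff a u \<noteq> 0" "gcoeff b (t - u) \<noteq> 0" using gcoeff_mult_nonzeroD[OF *(3)] by blast
  then have "K \<le> u" "L \<le> t - u" using * by auto
  then show "K + L \<le> t" by linarith
qed

lemma lowb_diag: "lowb K a \<Longrightarrow> lowb K (diag f a)"
  unfolding lowb_def by simp

lemma lowb_mon_mult: "lowb K a \<Longrightarrow> lowb (r + K) (mon r * a)"
  by (rule lowb_mult) (simp_all add: lowb_def gcoeff_mon)

text \<open>Only the exponents \<open>K\<close> and \<open>L\<close> can meet at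
  \<open>K + L\<close>. If a bound is not attained, both sides are 0.\<close>

lemma gcoeff_mult_lowest:
  assumes "lowb K a" "lowb L b"
  shows "gcoeff (a * b) (K + L) = gcoeff a K * gcoeff b L"
proof -
  have "u \<in> {K}" if "gcoeff a u \<noteq> 0" "gcoeff b (K + L - u) \<noteq> 0" for u
    using assms(1)[unfolded lowb_def, rule_format, OF that(1)] assms(2)[unfolded lowb_def, rule_format, OF that(2)] by simp
  then show ?thesis by (subst gcoeff_mult[where U = "{K}"]) auto
qed

text \<open>Coefficients of the recursion are kept finite: this yields a smallest positive exponent
  and a finite sum of absolute values, the data from which the radius is chosen.\<close>

definition fin :: "gs \<Rightarrow> bool" where
  "fin a \<longleftrightarrow> finite {t. gcoeff a t \<noteq> 0}"

lemma fin_0 [simp]: "fin 0" and fin_1 [simp]: "fin 1" and fin_mon [simp]: "fin (mon r)"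
  by (simp_all add: fin_def gcoeff_1 gcoeff_mon)

lemma fin_add: "fin a \<Longrightarrow> fin b \<Longrightarrow> fin (a + b)"
  unfolding fin_def by (rule finite_subset[of _ "{t. gcoeff a t \<noteq> 0} \<union> {t. gcoeff b t \<noteq> 0}"]) auto

lemma fin_uminus: "fin a \<Longrightarrow> fin (- a)"
  unfolding fin_def by simp

lemma fin_diff: "fin a \<Longrightarrow> fin b \<Longrightarrow> fin (a - b)"
  using fin_add[of a "- b"] fin_uminus by simp

lemma fin_mult: "fin a \<Longrightarrow> fin b \<Longrightarrow> fin (a * b)"
  unfolding fin_def
proof (rule finite_subset[of _ "(\<lambda>(u, v). u + v) ` ({t. gcoeff a t \<noteq> 0} \<times> {t. gcoeff b t \<noteq> 0})"])
  show "{t. gcoeff (a * b) t \<noteq> 0} \<subseteq> (\<lambda>(u, v). u + v) ` ({t. gcoeff a t \<noteq> 0} \<times> {t. gcoeff b t \<noteq> 0})"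
  proof
    fix t assume "t \<in> {t. gcoeff (a * b) t \<noteq> 0}"
    then obtain u where "gcoeff a u \<noteq> 0" "gcoeff b (t - u) \<noteq> 0" using gcoeff_mult_nonzeroD by blast
    then show "t \<in> (\<lambda>(u, v). u + v) ` ({t. gcoeff a t \<noteq> 0} \<times> {t. gcoeff b t \<noteq> 0})"
      by (intro image_eqI[of _ _ "(u, t - u)"]) auto
  qed
qed simp

lemma fin_sum_list: "(\<And>a. a \<in> set xs \<Longrightarrow> fin a) \<Longrightarrow> fin (sum_list xs)"
  by (induction xs) (auto intro: fin_add)

lemma fin_diag: "fin a \<Longrightarrow> fin (diag f a)"
  unfolding fin_def by (auto elim: rev_finite_subset)

section \<open>Truncated norms\<close>

text \<open>A weighted l^1 norm cut off at exponent \<open>t\<close>. As a finite sum it makes sense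
  before any convergence is known; a bound uniform in \<open>t\<close> is absolute convergence at
  radius \<open>r\<close>.\<close>

definition gnorm :: "real \<Rightarrow> real \<Rightarrow> gs \<Rightarrow> real" where
  "gnorm r t a = (\<Sum>\<mu> | \<mu> \<le> t \<and> gcoeff a \<mu> \<noteq> 0. cmod (gcoeff a \<mu>) * r powr \<mu>)"

lemma gnorm_nonneg [simp]: "0 \<le> gnorm r t a"
  unfolding gnorm_def by (intro sum_nonneg) simp

lemma gnorm_ge_sum:
  assumes "finite U" "\<And>\<mu>. \<mu> \<in> U \<Longrightarrow> \<mu> \<le> t"
  shows "(\<Sum>\<mu>\<in>U. cmod (gcoeff a \<mu>) * r powr \<mu>) \<le> gnorm r t a"
proof -
  have "(\<Sum>\<mu>\<in>U. cmod (gcoeff a \<mu>) * r powr \<mu>) =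
      (\<Sum>\<mu>\<in>{\<mu>\<in>U. gcoeff a \<mu> \<noteq> 0}. cmod (gcoeff a \<mu>) * r powr \<mu>)"
    using assms by (intro sum.mono_neutral_right) auto
  also have "\<dots> \<le> gnorm r t a"
    unfolding gnorm_def using assms finite_gcoeff by (intro sum_mono2) auto
  finally show ?thesis .
qed

lemma gnorm_eq_sum:
  assumes "finite U" "\<And>\<mu>. \<mu> \<le> t \<Longrightarrow> gcoeff a \<mu> \<noteq> 0 \<Longrightarrow> \<mu> \<in> U" "\<And>\<mu>. \<mu> \<in> U \<Longrightarrow> \<mu> \<le> t"
  shows "gnorm r t a = (\<Sum>\<mu>\<in>U. cmod (gcoeff a \<mu>) * r powr \<mu>)"
  unfolding gnorm_def using assms by (intro sum.mono_neutral_left) auto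

lemma gnorm_0 [simp]: "gnorm r t 0 = 0"
  by (simp add: gnorm_def)

lemma gnorm_add: "gnorm r t (a + b) \<le> gnorm r t a + gnorm r t b"
proof -
  let ?U = "{\<mu>. \<mu> \<le> t \<and> gcoeff a \<mu> \<noteq> 0} \<union> {\<mu>. \<mu> \<le> t \<and> gcoeff b \<mu> \<noteq> 0}"
  have U: "finite ?U" using finite_gcoeff by blast
  have "gnorm r t (a + b) = (\<Sum>\<mu>\<in>?U. cmod (gcoeff (a + b) \<mu>) * r powr \<mu>)"
    by (rule gnorm_eq_sum[OF U]) auto
  also have "\<dots> \<le> (\<Sum>\<mu>\<in>?U. cmod (gcoeff a \<mu>) * r powr \<mu> + cmod (gcoeff b \<mu>) * r powr \<mu>)"
    by (intro sum_mono) (simp add: distrib_right[symmetric] mult_right_mono norm_triangle_ineq)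
  also have "\<dots> = gnorm r t a + gnorm r t b"
    unfolding sum.distrib by (intro arg_cong2[of _ _ _ _ "(+)"] gnorm_eq_sum[OF U, symmetric]) auto
  finally show ?thesis .
qed

lemma gnorm_sum_list: "gnorm r t (sum_list (map f xs)) \<le> (\<Sum>x\<leftarrow>xs. gnorm r t (f x))"
  by (induction xs) (auto intro: order_trans[OF gnorm_add])

text \<open>Up to exponent \<open>t\<close> the product sees \<open>a\<close> only up to
  \<open>t - L\<close>, because the exponents of \<open>b\<close> start at \<open>L\<close>, and
  symmetrically for \<open>b\<close>. These shifted cut-offs carry the later induction.\<close>

lemma gnorm_mult:
  assumes "0 < r" "lowb K a" "lowb L b"
  shows "gnorm r t (a * b) \<le> gnorm r (t - L) a * gnorm r (t - K) b"
proof -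
  let ?M = "{\<mu>. \<mu> \<le> t \<and> gcoeff (a * b) \<mu> \<noteq> 0}"
  let ?U = "{u. u \<le> t - L \<and> gcoeff a u \<noteq> 0}"
  have "cmod (gcoeff (a * b) \<mu>) * r powr \<mu> \<le>
      (\<Sum>u\<in>?U. cmod (gcoeff a u) * r powr u * (cmod (gcoeff b (\<mu> - u)) * r powr (\<mu> - u)))"
    if "\<mu> \<in> ?M" for \<mu>
  proof -
    have "gcoeff (a * b) \<mu> = (\<Sum>u\<in>?U. gcoeff a u * gcoeff b (\<mu> - u))"
    proof (rule gcoeff_mult)
      fix u assume u: "gcoeff a u \<noteq> 0" "gcoeff b (\<mu> - u) \<noteq> 0"
      then have "L \<le> \<mu> - u" using assms(3) by (simp add: lowb_def)
      then show "u \<in> ?U" using u that by auto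
    qed (rule finite_gcoeff)
    then have "cmod (gcoeff (a * b) \<mu>) * r powr \<mu> \<le>
        (\<Sum>u\<in>?U. cmod (gcoeff a u) * cmod (gcoeff b (\<mu> - u))) * r powr \<mu>"
      by (simp add: norm_mult[symmetric] norm_sum mult_right_mono)
    also have "\<dots> = (\<Sum>u\<in>?U. cmod (gcoeff a u) * r powr u * (cmod (gcoeff b (\<mu> - u)) * r powr (\<mu> - u)))"
      unfolding sum_distrib_right
    proof (intro sum.cong refl)
      fix u
      have "r powr \<mu> = r powr u * r powr (\<mu> - u)" by (simp add: powr_add[symmetric])
      then show "cmod (gcoeff a u) * cmod (gcoeff b (\<mu> - u)) * r powr \<mu> =
          cmod (gcoeff a u) * r powr u * (cmod (gcoeff b (\<mu> - u)) * r powr (\<mu> - u))" by simp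
    qed
    finally show ?thesis .
  qed
  then have "gnorm r t (a * b) \<le>
      (\<Sum>\<mu>\<in>?M. \<Sum>u\<in>?U. cmod (gcoeff a u) * r powr u * (cmod (gcoeff b (\<mu> - u)) * r powr (\<mu> - u)))"
    unfolding gnorm_def by (rule sum_mono)
  also have "\<dots> = (\<Sum>u\<in>?U. cmod (gcoeff a u) * r powr u * (\<Sum>\<mu>\<in>?M. cmod (gcoeff b (\<mu> - u)) * r powr (\<mu> - u)))"
    by (subst sum.swap) (simp add: sum_distrib_left)
  also have "\<dots> \<le> (\<Sum>u\<in>?U. cmod (gcoeff a u) * r powr u * gnorm r (t - K) b)"
  proof (intro sum_mono mult_left_mono)
    fix u assume "u \<in> ?U"
    then have "K \<le> u" using assms(2) by (simp add: lowb_def)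
    have "(\<Sum>\<mu>\<in>?M. cmod (gcoeff b (\<mu> - u)) * r powr (\<mu> - u)) =
        (\<Sum>\<nu>\<in>(\<lambda>\<mu>. \<mu> - u) ` ?M. cmod (gcoeff b \<nu>) * r powr \<nu>)"
      by (subst sum.reindex) (auto simp: inj_on_def)
    also have "\<dots> \<le> gnorm r (t - K) b"
      using \<open>K \<le> u\<close> by (intro gnorm_ge_sum) (auto simp: finite_gcoeff)
    finally show "(\<Sum>\<mu>\<in>?M. cmod (gcoeff b (\<mu> - u)) * r powr (\<mu> - u)) \<le> gnorm r (t - K) b" .
  qed auto
  also have "\<dots> = gnorm r (t - L) a * gnorm r (t - K) b"
    by (simp add: gnorm_def sum_distrib_right)
  finally show ?thesis .
qed

lemma gnorm_1: "gnorm r t 1 \<le> 1"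
proof -
  have "gnorm r t 1 \<le> (\<Sum>\<mu>\<in>{0::real}. 1)"
    unfolding gnorm_def by (intro sum_le_included[where i = id]) (auto simp: gcoeff_1 powr_def)
  then show ?thesis by simp
qed

lemma lowb_prod_list:
  "(\<And>x. x \<in> set xs \<Longrightarrow> lowb K x) \<Longrightarrow> lowb (of_nat (length xs) * K) (prod_list xs)"
proof (induction xs)
  case (Cons x xs)
  then have "lowb (K + of_nat (length xs) * K) (x * prod_list xs)" by (intro lowb_mult) auto
  then show ?case by (simp add: algebra_simps)
qed (simp add: lowb_1)

lemma gnorm_prod_list:
  assumes "0 < r" "\<And>x. x \<in> set xs \<Longrightarrow> lowb 0 x" "\<And>x. x \<in> set xs \<Longrightarrow> gnorm r t x \<le> C"
  shows "gnorm r t (prod_list xs) \<le> C ^ length xs"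
  using assms(2,3)
proof (induction xs)
  case (Cons x xs)
  have "lowb 0 (prod_list xs)" using lowb_prod_list[of xs 0] Cons.prems by simp
  then have "gnorm r t (x * prod_list xs) \<le> gnorm r t x * gnorm r t (prod_list xs)"
    using gnorm_mult[OF assms(1), of 0 x 0 "prod_list xs" t] Cons.prems by simp
  also have "\<dots> \<le> C * C ^ length xs"
  proof (intro mult_mono)
    show "gnorm r t x \<le> C" using Cons.prems by simp
    then show "0 \<le> C" using gnorm_nonneg[of r t x] by linarith
  qed (use Cons in auto)
  finally show ?case by simp
qed (simp add: gnorm_1)

lemma gnorm_diag:
  assumes "\<And>\<mu>. gcoeff a \<mu> \<noteq> 0 \<Longrightarrow> cmod (f \<mu>) \<le> C * cmod (g \<mu>)"
  shows "gnorm r t (diag f a) \<le> C * gnorm r t (diag g a)"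
proof -
  let ?U = "{\<mu>. \<mu> \<le> t \<and> gcoeff a \<mu> \<noteq> 0}"
  have U: "finite ?U" by (rule finite_gcoeff)
  have eq: "gnorm r t (diag h a) = (\<Sum>\<mu>\<in>?U. cmod (h \<mu>) * cmod (gcoeff a \<mu>) * r powr \<mu>)" for h
    by (subst gnorm_eq_sum[OF U]) (auto simp: norm_mult)
  have "(\<Sum>\<mu>\<in>?U. cmod (f \<mu>) * cmod (gcoeff a \<mu>) * r powr \<mu>) \<le>
      (\<Sum>\<mu>\<in>?U. C * cmod (g \<mu>) * cmod (gcoeff a \<mu>) * r powr \<mu>)"
    using assms by (intro sum_mono mult_right_mono) auto
  then show ?thesis by (simp add: eq sum_distrib_left mult.assoc)
qed

lemma fin_positive_gap:
  assumes "finite B" "\<And>b. b \<in> B \<Longrightarrow> fin b" "\<And>b \<mu>. b \<in> B \<Longrightarrow> gcoeff b \<mu> \<noteq> 0 \<Longrightarrow> 0 < \<mu>"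
  obtains \<epsilon> where "0 < \<epsilon>" "\<And>b. b \<in> B \<Longrightarrow> lowb \<epsilon> b"
proof -
  \<comment> \<open>The extra 1 keeps the set nonempty when all coefficients vanish.\<close>
  let ?S = "insert 1 (\<Union>b\<in>B. {\<mu>. gcoeff b \<mu> \<noteq> 0})"
  have fS: "finite ?S" using assms(1,2) by (auto simp: fin_def)
  have "0 < Min ?S" using fS assms(3) by (subst Min_gr_iff) auto
  moreover have "lowb (Min ?S) b" if "b \<in> B" for b
    unfolding lowb_def using fS that by (intro allI impI Min_le) auto
  ultimately show ?thesis using that by blast
qed

text \<open>The series itself serves as its own majorant: every coefficient series on the right has
  exponents at least some \<open>\<epsilon> > 0\<close>, so the truncated norm up to \<open>t\<close> is controlled by the one up to
  \<open>t - \<epsilon>\<close>, with a constant that tends to \<open>0\<close> with \<open>r\<close>.\<close>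
lemma small_perturbation_bound:
  fixes Ts :: "(gs \<times> nat list) list"
  assumes pos: "\<And>\<mu>. gcoeff u \<mu> \<noteq> 0 \<Longrightarrow> 0 < \<mu>"
    and bound: "\<And>\<mu> i. 0 < \<mu> \<Longrightarrow> i \<in> I \<Longrightarrow> cmod (\<psi> i \<mu>) \<le> C * cmod (p \<mu>)"
    and "0 \<le> C"
    and Ts: "\<And>b ws. (b, ws) \<in> set Ts \<Longrightarrow> fin b \<and> set ws \<subseteq> I \<and> (\<forall>\<mu>. gcoeff b \<mu> \<noteq> 0 \<longrightarrow> 0 < \<mu>)"
    and eq: "diag p u = (\<Sum>(b, ws)\<leftarrow>Ts. b * prod_list (map (\<lambda>i. diag (\<psi> i) u) ws))"
  obtains r where "0 < r" "r < 1" "\<And>t. gnorm r t (diag p u) \<le> 1"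
proof -
  obtain \<epsilon> where \<epsilon>: "0 < \<epsilon>" "\<And>b. b \<in> fst ` set Ts \<Longrightarrow> lowb \<epsilon> b"
    by (rule fin_positive_gap[of "fst ` set Ts"]) (use Ts in auto)
  define N where "N b = (\<Sum>\<mu> | gcoeff b \<mu> \<noteq> 0. cmod (gcoeff b \<mu>))" for b
  define B where "B = (\<Sum>(b, ws)\<leftarrow>Ts. C ^ length ws * N b)"
  have N0: "0 \<le> N b" for b unfolding N_def by (intro sum_nonneg) simp
  have B0: "0 \<le> B" unfolding B_def using \<open>0 \<le> C\<close> N0 by (intro sum_list_nonneg) auto
  \<comment> \<open>Chosen so that \<open>r powr \<epsilon> = 1 / (B + 2)\<close>: this makes
    \<open>r powr \<epsilon> * B\<close> at most 1, and the 2 keeps \<open>r\<close> below 1 even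
    for \<open>B = 0\<close>.\<close>
  define r where "r = (1 / (B + 2)) powr (1 / \<epsilon>)"
  have r: "0 < r" "r < 1" and r\<epsilon>: "r powr \<epsilon> * B \<le> 1"
  proof -
    show "0 < r" using B0 by (simp add: r_def)
    show "r < 1" unfolding r_def using B0 \<epsilon>(1) powr_less_mono2[of "1/\<epsilon>" "1 / (B + 2)" 1] by simp
    have "r powr \<epsilon> = 1 / (B + 2)" using \<epsilon>(1) B0 by (simp add: r_def powr_powr)
    then show "r powr \<epsilon> * B \<le> 1" using B0 by simp
  qed
  have nb: "gnorm r t b \<le> r powr \<epsilon> * N b" if "fin b" "lowb \<epsilon> b" for b t
  proof -
    have "gnorm r t b \<le> (\<Sum>\<mu> | \<mu> \<le> t \<and> gcoeff b \<mu> \<noteq> 0. cmod (gcoeff b \<mu>) * r powr \<epsilon>)"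
      unfolding gnorm_def
      using r that(2) by (intro sum_mono mult_left_mono powr_mono') (auto simp: lowb_def)
    also have "\<dots> \<le> (\<Sum>\<mu> | gcoeff b \<mu> \<noteq> 0. cmod (gcoeff b \<mu>) * r powr \<epsilon>)"
      using that(1) by (intro sum_mono2) (auto simp: fin_def)
    finally show ?thesis by (simp add: N_def sum_distrib_left mult.commute)
  qed
  have u0: "lowb 0 u" using pos unfolding lowb_def by force
  \<comment> \<open>The exponents of \<open>b\<close> start at \<open>\<epsilon>\<close>, so only
    the part of each factor up to \<open>t - \<epsilon>\<close> enters, and there it is dominated by
    \<open>diag p u\<close>. The bound thus climbs in steps of \<open>\<epsilon>\<close>.\<close>
  have step: "gnorm r t (diag p u) \<le> 1" if IH: "gnorm r (t - \<epsilon>) (diag p u) \<le> 1" for t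
  proof -
    have "gnorm r t (b * prod_list (map (\<lambda>i. diag (\<psi> i) u) ws)) \<le> r powr \<epsilon> * (C ^ length ws * N b)"
      if bw: "(b, ws) \<in> set Ts" for b ws
    proof -
      let ?Z = "map (\<lambda>i. diag (\<psi> i) u) ws"
      have fb: "fin b" "lowb \<epsilon> b" using Ts[OF bw] \<epsilon>(2) bw by force+
      have Z0: "lowb 0 (prod_list ?Z)" using lowb_prod_list[of ?Z 0] u0 by (auto intro: lowb_diag)
      have "gnorm r (t - \<epsilon>) (prod_list ?Z) \<le> C ^ length ?Z"
      proof (rule gnorm_prod_list[OF r(1)])
        fix x assume "x \<in> set ?Z"
        then obtain i where i: "x = diag (\<psi> i) u" "i \<in> I" using Ts[OF bw] by auto
        show "lowb 0 x" using u0 i by (simp add: lowb_diag)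
        have "gnorm r (t - \<epsilon>) x \<le> C * gnorm r (t - \<epsilon>) (diag p u)"
          unfolding i(1) using bound pos i(2) by (intro gnorm_diag) auto
        also have "\<dots> \<le> C * 1" using IH \<open>0 \<le> C\<close> by (intro mult_left_mono)
        finally show "gnorm r (t - \<epsilon>) x \<le> C" by simp
      qed
      moreover have "gnorm r t (b * prod_list ?Z) \<le> gnorm r t b * gnorm r (t - \<epsilon>) (prod_list ?Z)"
        using gnorm_mult[OF r(1) fb(2) Z0, of t] by simp
      moreover have "gnorm r t b * gnorm r (t - \<epsilon>) (prod_list ?Z) \<le> (r powr \<epsilon> * N b) * C ^ length ?Z"
        using calculation(1) nb[OF fb] N0 by (intro mult_mono) auto
      ultimately show ?thesis by (simp add: mult.commute mult.left_commute)
    qed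
    then have "(\<Sum>(b, ws)\<leftarrow>Ts. gnorm r t (b * prod_list (map (\<lambda>i. diag (\<psi> i) u) ws))) \<le>
        (\<Sum>(b, ws)\<leftarrow>Ts. r powr \<epsilon> * (C ^ length ws * N b))"
      by (intro sum_list_mono) auto
    also have "\<dots> = r powr \<epsilon> * B"
      by (simp add: B_def sum_list_const_mult case_prod_unfold)
    also have "\<dots> \<le> 1" by (rule r\<epsilon>)
    finally show ?thesis
      unfolding eq using order_trans[OF gnorm_sum_list] by (simp add: case_prod_unfold)
  qed
  have "\<forall>t \<le> of_nat k * \<epsilon>. gnorm r t (diag p u) \<le> 1" for k :: nat
  proof (induction k)
    case 0
    have "{\<mu>. \<mu> \<le> t \<and> gcoeff (diag p u) \<mu> \<noteq> 0} = {}" if "t \<le> 0" for t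
      using pos that by force
    then show ?case by (simp add: gnorm_def del: gcoeff_diag)
  next
    case (Suc k)
    show ?case
    proof (intro allI impI)
      fix t assume "t \<le> of_nat (Suc k) * \<epsilon>"
      then have "t - \<epsilon> \<le> of_nat k * \<epsilon>" by (simp add: algebra_simps)
      then have "gnorm r (t - \<epsilon>) (diag p u) \<le> 1" using Suc by blast
      then show "gnorm r t (diag p u) \<le> 1" by (rule step)
    qed
  qed
  moreover have "\<exists>k::nat. t \<le> of_nat k * \<epsilon>" for t
    using \<epsilon>(1) real_arch_simple[of "t / \<epsilon>"] by (auto simp: field_simps)
  ultimately have "gnorm r t (diag p u) \<le> 1" for t by blast
  then show ?thesis using that r by blast
qed

section \<open>Taylor expansion of polynomials in words\<close>

text \<open>A polynomial in \<open>y\<^sub>0, y\<^sub>1, \<dots>\<close> is represented by a list of pairs of a coefficient and a word, the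
  list of the indices of the variables in the monomial; \<open>pd i y ws\<close> is the value at \<open>y\<close> of the partial
  derivative of the monomial \<open>ws\<close>.\<close>
abbreviation wprod :: "(nat \<Rightarrow> gs) \<Rightarrow> nat list \<Rightarrow> gs" where
  "wprod y ws \<equiv> prod_list (map y ws)"

fun pd :: "nat \<Rightarrow> (nat \<Rightarrow> gs) \<Rightarrow> nat list \<Rightarrow> gs" where
  "pd i y [] = 0"
| "pd i y (j # ws) = (if i = j then wprod y ws else 0) + y j * pd i y ws"

text \<open>The terms of order at least two in the increment \<open>w\<close>. Multiplying the
  expansion of the tail by \<open>y j + w j\<close> contributes \<open>y j\<close> times the rest of
  the tail, \<open>w j\<close> times its linear part, and \<open>w j\<close> times its rest, in the
  order of the three lists.\<close>

fun taylor_rest :: "nat \<Rightarrow> (nat \<Rightarrow> gs) \<Rightarrow> nat list \<Rightarrow> (gs \<times> nat list) list" where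
  "taylor_rest N y [] = []"
| "taylor_rest N y (j # ws) =
     map (\<lambda>(b, vs). (y j * b, vs)) (taylor_rest N y ws) @
     map (\<lambda>i. (pd i y ws, [j, i])) [0..<N] @
     map (\<lambda>(b, vs). (b, j # vs)) (taylor_rest N y ws)"

lemma wprod_taylor:
  assumes "set ws \<subseteq> {..<N}"
  shows "wprod (\<lambda>i. y i + w i) ws =
    wprod y ws + (\<Sum>i<N. pd i y ws * w i) + (\<Sum>(b, vs)\<leftarrow>taylor_rest N y ws. b * wprod w vs)"
  using assms
proof (induction ws)
  case (Cons j ws)
  let ?R = "\<Sum>(b, vs)\<leftarrow>taylor_rest N y ws. b * wprod w vs"
  let ?L = "\<Sum>i<N. pd i y ws * w i"
  have IH: "wprod (\<lambda>i. y i + w i) ws = wprod y ws + ?L + ?R" using Cons by simp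
  have "pd i y (j # ws) * w i = (if i = j then wprod y ws * w j else 0) + y j * (pd i y ws * w i)" for i
    by (simp add: algebra_simps)
  then have "(\<Sum>i<N. pd i y (j # ws) * w i) =
      (\<Sum>i<N. (if i = j then wprod y ws * w j else 0) + y j * (pd i y ws * w i))"
    by presburger
  then have L: "(\<Sum>i<N. pd i y (j # ws) * w i) = wprod y ws * w j + y j * ?L"
    using Cons.prems by (simp only: sum.distrib sum_distrib_left) simp
  have "(\<Sum>(b, vs)\<leftarrow>taylor_rest N y (j # ws). b * wprod w vs) =
      y j * ?R + (\<Sum>i\<leftarrow>[0..<N]. pd i y ws * (w j * w i)) + w j * ?R"
    by (simp add: comp_def case_prod_unfold sum_list_const_mult[symmetric] algebra_simps)
  also have "(\<Sum>i\<leftarrow>[0..<N]. pd i y ws * (w j * w i)) = w j * ?L"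
    by (simp add: interv_sum_list_conv_sum_set_nat atLeast0LessThan sum_distrib_left algebra_simps)
  finally have R: "(\<Sum>(b, vs)\<leftarrow>taylor_rest N y (j # ws). b * wprod w vs) = y j * ?R + w j * ?L + w j * ?R" .
  have "wprod (\<lambda>i. y i + w i) (j # ws) = (y j + w j) * (wprod y ws + ?L + ?R)"
    using IH by simp
  then show ?case unfolding L R by (simp add: distrib_left distrib_right ac_simps)
qed simp

lemma lowb_wprod:
  assumes "\<And>i. i \<in> set ws \<Longrightarrow> lowb (- K) (y i)"
  shows "lowb (- (K * length ws)) (wprod y ws)"
  using lowb_prod_list[of "map y ws" "- K"] assms by (auto simp: mult.commute)

lemma lowb_pd:
  assumes "0 \<le> K" "\<And>i. i \<in> set ws \<Longrightarrow> lowb (- K) (y i)"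
  shows "lowb (- (K * length ws)) (pd i y ws)"
  using assms(2)
proof (induction ws)
  case (Cons j ws)
  have "lowb (- (K * length (j # ws))) (wprod y ws)"
    by (rule lowb_mono[OF lowb_wprod[of ws K y]]) (use Cons.prems assms(1) in \<open>auto simp: algebra_simps\<close>)
  moreover have "lowb (- K + - (K * length ws)) (y j * pd i y ws)"
    using Cons by (intro lowb_mult) auto
  then have "lowb (- (K * length (j # ws))) (y j * pd i y ws)" by (simp add: algebra_simps)
  ultimately show ?case by (auto intro!: lowb_add)
qed simp

lemma fin_wprod: "(\<And>i. i \<in> set ws \<Longrightarrow> fin (y i)) \<Longrightarrow> fin (wprod y ws)"
  by (induction ws) (auto intro: fin_mult)

lemma fin_pd: "(\<And>i. i \<in> set ws \<Longrightarrow> fin (y i)) \<Longrightarrow> fin (pd i y ws)"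
  by (induction ws) (auto intro!: fin_mult fin_add fin_wprod)

text \<open>The crucial part is \<open>2 \<le> length vs\<close>: when \<open>w\<close> starts
  beyond a large exponent \<open>T\<close>, two factors of it outweigh the later division by a
  single \<open>x^T\<close>.\<close>

lemma taylor_rest_bounds:
  assumes "0 \<le> K" "set ws \<subseteq> {..<N}" "\<And>i. i < N \<Longrightarrow> fin (y i) \<and> lowb (- K) (y i)"
    "(b, vs) \<in> set (taylor_rest N y ws)"
  shows "fin b \<and> lowb (- (K * length ws)) b \<and> 2 \<le> length vs \<and> set vs \<subseteq> {..<N}"
  using assms(2,4)
proof (induction ws arbitrary: b vs)
  case (Cons j ws)
  have mono: "- (K * length (j # ws)) \<le> - (K * length ws)" using assms(1) by (simp add: algebra_simps)
  have y: "fin (y i)" "lowb (- K) (y i)" if "i \<in> set (j # ws)" for i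
    using assms(3) Cons.prems(1) that by auto
  from Cons.prems(2) consider
      (a) b' where "(b', vs) \<in> set (taylor_rest N y ws)" "b = y j * b'"
    | (b) i where "i < N" "b = pd i y ws" "vs = [j, i]"
    | (c) vs' where "(b, vs') \<in> set (taylor_rest N y ws)" "vs = j # vs'"
    by auto
  then show ?case
  proof cases
    case a
    have IH: "fin b' \<and> lowb (- (K * length ws)) b' \<and> 2 \<le> length vs \<and> set vs \<subseteq> {..<N}"
      using Cons.IH[OF _ a(1)] Cons.prems(1) by simp
    have "lowb (- K + - (K * length ws)) b"
      unfolding a(2) using y IH by (intro lowb_mult) auto
    then show ?thesis using IH a y by (auto simp: algebra_simps intro: fin_mult)
  next
    case b
    have "lowb (- (K * length ws)) b" unfolding b(2) using y by (intro lowb_pd assms) auto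
    moreover have "fin b" unfolding b(2) using y by (intro fin_pd) auto
    ultimately show ?thesis using b Cons.prems(1) lowb_mono[OF _ mono] by auto
  next
    case c
    then show ?thesis using Cons.IH[OF _ c(1)] Cons.prems(1) lowb_mono[OF _ mono] by auto
  qed
qed simp

text \<open>Telescoping letter by letter: every summand has one difference factor, of order at least
  \<open>M\<close>, while the other factors have order at least \<open>-K\<close>.\<close>

lemma lowb_wprod_diff:
  assumes "0 \<le> K" "\<And>i. i \<in> set ws \<Longrightarrow> lowb (- K) (y i) \<and> lowb (- K) (z i) \<and> lowb M (y i - z i)"
  shows "lowb (M - K * length ws) (wprod y ws - wprod z ws)"
  using assms(2)
proof (induction ws)
  case (Cons j ws)
  have le: "M - K * length (j # ws) \<le> - K + (M - K * length ws)"
    "M - K * length (j # ws) \<le> M + - (K * length ws)"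
    using assms(1) by (simp_all add: algebra_simps)
  have "lowb (- K + (M - K * length ws)) (y j * (wprod y ws - wprod z ws))"
    using Cons by (intro lowb_mult) auto
  moreover have "lowb (M + - (K * length ws)) ((y j - z j) * wprod z ws)"
    using Cons.prems by (intro lowb_mult lowb_wprod) auto
  ultimately have "lowb (M - K * length (j # ws))
      (y j * (wprod y ws - wprod z ws) + (y j - z j) * wprod z ws)"
    using le lowb_mono by (intro lowb_add) blast+
  moreover have "wprod y (j # ws) - wprod z (j # ws) =
      y j * (wprod y ws - wprod z ws) + (y j - z j) * wprod z ws"
    by (simp add: algebra_simps)
  ultimately show ?case by (simp only:)
qed simp

lemma lowb_pd_diff:
  assumes "0 \<le> K" "\<And>i. i \<in> set ws \<Longrightarrow> lowb (- K) (y i) \<and> lowb (- K) (z i) \<and> lowb M (y i - z i)"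
  shows "lowb (M - K * length ws) (pd i y ws - pd i z ws)"
  using assms(2)
proof (induction ws)
  case (Cons j ws)
  have le: "M - K * length (j # ws) \<le> - K + (M - K * length ws)"
    "M - K * length (j # ws) \<le> M + - (K * length ws)"
    "M - K * length (j # ws) \<le> M - K * length ws"
    using assms(1) by (simp_all add: algebra_simps)
  have "lowb (M - K * length ws) (wprod y ws - wprod z ws)"
    using Cons.prems by (intro lowb_wprod_diff assms(1)) auto
  then have "lowb (M - K * length ws) (if i = j then wprod y ws - wprod z ws else 0)"
    by simp
  moreover have "lowb (- K + (M - K * length ws)) (y j * (pd i y ws - pd i z ws))"
    using Cons by (intro lowb_mult) auto
  moreover have "lowb (M + - (K * length ws)) ((y j - z j) * pd i z ws)"
    using Cons.prems assms(1) by (intro lowb_mult lowb_pd) auto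
  ultimately have "lowb (M - K * length (j # ws)) ((if i = j then wprod y ws - wprod z ws else 0) +
      (y j * (pd i y ws - pd i z ws) + (y j - z j) * pd i z ws))"
    using le lowb_mono by (intro lowb_add) blast+
  moreover have "pd i y (j # ws) - pd i z (j # ws) =
      (if i = j then wprod y ws - wprod z ws else 0) + (y j * (pd i y ws - pd i z ws) + (y j - z j) * pd i z ws)"
    by (simp add: algebra_simps)
  ultimately show ?case by (simp only:)
qed simp

definition cst :: "complex \<Rightarrow> gs" where
  "cst c = diag (\<lambda>_. c) 1"

lemma gcoeff_cst: "gcoeff (cst c) t = (if t = 0 then c else 0)"
  by (simp add: cst_def gcoeff_1)

lemma gcoeff_cst_mult [simp]: "gcoeff (cst c * a) t = c * gcoeff a t"
  by (subst gcoeff_mult[where U = "{0}"]) (auto simp: gcoeff_cst split: if_splits)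

lemma fin_cst: "fin (cst c)"
  unfolding cst_def by (intro fin_diag fin_1)

lemma gcoeff_positive_mult:
  assumes "lowb 0 a" "\<And>\<mu>. gcoeff b \<mu> \<noteq> 0 \<Longrightarrow> 0 < \<mu>" "gcoeff (a * b) \<mu> \<noteq> 0"
  shows "0 < \<mu>"
proof -
  obtain u where "gcoeff a u \<noteq> 0" "gcoeff b (\<mu> - u) \<noteq> 0" using gcoeff_mult_nonzeroD[OF assms(3)] .
  then have "0 \<le> u" "0 < \<mu> - u" using assms(1,2) unfolding lowb_def by blast+
  then show ?thesis by simp
qed

lemma gcoeff_positive_sum:
  assumes "gcoeff (sum_list xs) \<mu> \<noteq> 0" "\<And>x \<mu>. x \<in> set xs \<Longrightarrow> gcoeff x \<mu> \<noteq> 0 \<Longrightarrow> 0 < \<mu>"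
  shows "0 < \<mu>"
proof (rule ccontr)
  assume "\<not> 0 < \<mu>"
  then have "gcoeff x \<mu> = 0" if "x \<in> set xs" for x using assms(2) that by blast
  then have "map (\<lambda>x. gcoeff x \<mu>) xs = map (\<lambda>x. 0) xs" by simp
  then have "gcoeff (sum_list xs) \<mu> = 0" by (simp add: gcoeff_sum_list del: map_eq_conv)
  then show False using assms(1) by simp
qed

lemma sum_list_lessThan: "(\<Sum>i<N. f i) = (\<Sum>i\<leftarrow>[0..<N]. f i)"
  by (simp add: interv_sum_list_conv_sum_set_nat atLeast0LessThan)

lemma sum_list_le_length_mult:
  fixes f :: "'a \<Rightarrow> real"
  assumes "\<And>x. x \<in> set xs \<Longrightarrow> c \<le> f x"
  shows "of_nat (length xs) * c \<le> (\<Sum>x\<leftarrow>xs. f x)"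
  using assms by (induction xs) (force simp: algebra_simps)+

lemma wprod_mon: "wprod (\<lambda>i. mon (e i) * Z i) vs = mon (\<Sum>i\<leftarrow>vs. e i) * wprod Z vs"
  by (induction vs) (simp_all add: mon_0 mon_mult[symmetric] mult.commute mult.left_commute)

section \<open>Convergence in the regular singular case\<close>

text \<open>Common shape of the i-th iterates: multiply the coefficient at exponent mu by
  \<open>\<phi> i\<close> of mu, then lower all exponents by \<open>d i\<close>.\<close>

definition shiftop :: "(nat \<Rightarrow> real) \<Rightarrow> (nat \<Rightarrow> real \<Rightarrow> complex) \<Rightarrow> gs \<Rightarrow> nat \<Rightarrow> gs" where
  "shiftop d \<phi> a i = mon (- d i) * diag (\<phi> i) a"

lemma shiftop_add: "shiftop d \<phi> (a + b) i = shiftop d \<phi> a i + shiftop d \<phi> b i"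
  by (simp add: shiftop_def diag_add distrib_left)

lemma shiftop_mon: "shiftop d \<phi> (mon T * u) i = mon (T - d i) * diag (\<lambda>\<mu>. \<phi> i (\<mu> + T)) u"
  by (simp add: shiftop_def diag_mon mon_mult_assoc)

lemma lowb_shiftop:
  assumes "lowb L a" "d i \<le> \<Delta>"
  shows "lowb (L - \<Delta>) (shiftop d \<phi> a i)"
  unfolding shiftop_def
  using lowb_mon_mult[OF lowb_diag[OF assms(1)], of "- d i" "\<phi> i"] assms(2) by (auto elim: lowb_mono)

lemma fin_shiftop: "fin a \<Longrightarrow> fin (shiftop d \<phi> a i)"
  unfolding shiftop_def by (intro fin_mult fin_mon fin_diag)

definition words_eval :: "(gs \<times> nat list) list \<Rightarrow> (nat \<Rightarrow> gs) \<Rightarrow> gs" where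
  "words_eval Ps y = (\<Sum>(c, ws)\<leftarrow>Ps. c * wprod y ws)"

definition words_pd :: "(gs \<times> nat list) list \<Rightarrow> nat \<Rightarrow> (nat \<Rightarrow> gs) \<Rightarrow> gs" where
  "words_pd Ps i y = (\<Sum>(c, ws)\<leftarrow>Ps. c * pd i y ws)"

lemma words_eval_taylor:
  assumes "\<And>c ws. (c, ws) \<in> set Ps \<Longrightarrow> set ws \<subseteq> {..<N}"
  shows "words_eval Ps (\<lambda>i. y i + w i) = words_eval Ps y + (\<Sum>i<N. words_pd Ps i y * w i) +
    words_eval (concat (map (\<lambda>(c, ws). map (\<lambda>(b, vs). (c * b, vs)) (taylor_rest N y ws)) Ps)) w"
  using assms
proof (induction Ps)
  case Nil
  then show ?case by (simp add: words_eval_def words_pd_def)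
next
  case (Cons x Ps)
  obtain c ws where x: "x = (c, ws)" by fastforce
  let ?Q = "concat (map (\<lambda>(c, ws). map (\<lambda>(b, vs). (c * b, vs)) (taylor_rest N y ws)) Ps)"
  have IH: "words_eval Ps (\<lambda>i. y i + w i) = words_eval Ps y + (\<Sum>i<N. words_pd Ps i y * w i) + words_eval ?Q w"
    using Cons.IH Cons.prems by force
  have T: "wprod (\<lambda>i. y i + w i) ws =
    wprod y ws + (\<Sum>i<N. pd i y ws * w i) + (\<Sum>(b, vs)\<leftarrow>taylor_rest N y ws. b * wprod w vs)"
    using Cons.prems x by (intro wprod_taylor) auto
  have "words_eval (x # Ps) (\<lambda>i. y i + w i) =
      c * wprod (\<lambda>i. y i + w i) ws + words_eval Ps (\<lambda>i. y i + w i)"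
    by (simp add: words_eval_def x)
  also have "\<dots> = (c * wprod y ws + words_eval Ps y) +
      (c * (\<Sum>i<N. pd i y ws * w i) + (\<Sum>i<N. words_pd Ps i y * w i)) +
      (c * (\<Sum>(b, vs)\<leftarrow>taylor_rest N y ws. b * wprod w vs) + words_eval ?Q w)"
    unfolding IH T by (simp add: distrib_left ac_simps)
  also have "c * wprod y ws + words_eval Ps y = words_eval (x # Ps) y"
    by (simp add: words_eval_def x)
  also have "c * (\<Sum>i<N. pd i y ws * w i) + (\<Sum>i<N. words_pd Ps i y * w i) =
      (\<Sum>i<N. words_pd (x # Ps) i y * w i)"
    by (simp add: words_pd_def x sum_distrib_left sum.distrib distrib_right mult.assoc)
  also have "c * (\<Sum>(b, vs)\<leftarrow>taylor_rest N y ws. b * wprod w vs) + words_eval ?Q w =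
      words_eval (concat (map (\<lambda>(c, ws). map (\<lambda>(b, vs). (c * b, vs)) (taylor_rest N y ws)) (x # Ps))) w"
    by (simp add: words_eval_def x sum_list_const_mult[symmetric] comp_def case_prod_unfold mult.assoc)
  finally show ?case .
qed

definition trunc_le :: "real \<Rightarrow> gs \<Rightarrow> gs" where
  "trunc_le T = diag (\<lambda>\<mu>. if \<mu> \<le> T then 1 else 0)"

definition trunc_gt :: "real \<Rightarrow> gs \<Rightarrow> gs" where
  "trunc_gt T = diag (\<lambda>\<mu>. if \<mu> \<le> T then 0 else 1)"

lemma trunc_split: "s = trunc_le T s + trunc_gt T s"
  by (rule gs_eqI) (simp add: trunc_le_def trunc_gt_def)

lemma fin_trunc_le: "fin (trunc_le T s)"
  unfolding fin_def trunc_le_def by (rule finite_subset[OF _ finite_gcoeff[of T s]]) auto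

text \<open>A solution whose linearization has lowest-order symbol dominating all the symbols
  \<open>\<phi> i\<close> (i.e. is regular singular) converges. With \<open>s = s\<^sub>0 + x\<^sup>T u\<close>, \<open>s\<^sub>0\<close> a long truncation,
  dividing the Taylor expansion at \<open>s\<^sub>0\<close> by \<open>x\<^sup>v\<^sup>+\<^sup>T\<close> puts the equation for \<open>u\<close> into
  the shape required by \<open>small_perturbation_bound\<close>.\<close>
lemma regular_singular_convergence:
  fixes Ps :: "(gs \<times> nat list) list" and s :: gs
  assumes Ps: "\<And>c ws. (c, ws) \<in> set Ps \<Longrightarrow> fin c \<and> lowb 0 c \<and> set ws \<subseteq> {..<N}"
    and zero: "words_eval Ps (shiftop d \<phi> s) = 0"
    and d: "\<And>i. i < N \<Longrightarrow> 0 \<le> d i"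
    and A: "\<And>i. A i = mon (- d i) * words_pd Ps i (shiftop d \<phi> s)"
    and lowA: "\<And>i. i < N \<Longrightarrow> lowb v (A i)"
    and p: "\<And>\<mu>. p \<mu> = (\<Sum>i<N. gcoeff (A i) v * \<phi> i \<mu>)"
    and "0 \<le> C"
    and bound: "\<And>\<mu> i. T0 < \<mu> \<Longrightarrow> i < N \<Longrightarrow> cmod (\<phi> i \<mu>) \<le> C * cmod (p \<mu>)"
    and bound1: "\<And>\<mu>. T0 < \<mu> \<Longrightarrow> 1 \<le> C * cmod (p \<mu>)"
  shows "\<exists>r T. 0 < r \<and> r < 1 \<and> 0 \<le> T \<and>
    (\<forall>U. finite U \<and> U \<subseteq> {T<..} \<longrightarrow> (\<Sum>\<mu>\<in>U. cmod (gcoeff s \<mu>) * r powr \<mu>) \<le> C)"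
proof -
  obtain L where L: "lowb L s" using lowb_exists by blast
  define \<Delta> where "\<Delta> = (\<Sum>i<N. d i)"
  have \<Delta>: "0 \<le> \<Delta>" "\<And>i. i < N \<Longrightarrow> d i \<le> \<Delta>"
    unfolding \<Delta>_def using d by (auto intro!: sum_nonneg member_le_sum)
  define K where "K = \<bar>L\<bar> + \<Delta>"
  have K: "0 \<le> K" using \<Delta> by (simp add: K_def)
  define m where "m = Max (insert 0 ((\<lambda>(c, ws). length ws) ` set Ps))"
  have m: "length ws \<le> m" if "(c, ws) \<in> set Ps" for c ws
    unfolding m_def using that by (intro Max_ge) force+
  \<comment> \<open>The last entry ensures \<open>2 * \<Delta> + v + K * m < T\<close>. Hence the
    linear coefficients at \<open>s0\<close> and at \<open>s\<close> agree through order
    \<open>v\<close>, and the quadratic terms start above order \<open>v + T\<close>. The entry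
    \<open>T0\<close> gives access to the symbol bounds, and 0 makes \<open>r powr T\<close> at most
    1.\<close>
  define T where "T = Max {0, T0, \<Delta>, 2 * \<Delta> + v + K * m + 1}"
  have T: "0 \<le> T" "T0 \<le> T" "\<Delta> \<le> T" "2 * \<Delta> + v + K * m < T"
  proof -
    have "2 * \<Delta> + v + K * m + 1 \<le> T" unfolding T_def by (rule Max_ge) auto
    then show "2 * \<Delta> + v + K * m < T" by simp
  qed (auto simp: T_def)
  define s0 w where "s0 = trunc_le T s" and "w = trunc_gt T s"
  have s: "s = s0 + w" unfolding s0_def w_def by (rule trunc_split)
  have fs0: "fin s0" unfolding s0_def by (rule fin_trunc_le)
  define y0 where "y0 = shiftop d \<phi> s0"
  define yw where "yw = shiftop d \<phi> w"
  define ys where "ys = shiftop d \<phi> s"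
  have ysum: "ys = (\<lambda>i. y0 i + yw i)" unfolding ys_def y0_def yw_def s by (simp add: shiftop_add fun_eq_iff)
  have lw: "lowb T w" unfolding w_def trunc_gt_def lowb_def by auto
  have ls0: "lowb L s0" using L unfolding s0_def trunc_le_def by (rule lowb_diag)
  have LK: "- K \<le> L - \<Delta>" by (simp add: K_def)
  have lows: "lowb (- K) (ys i)" "lowb (- K) (y0 i)" "lowb (T - \<Delta>) (yw i)" "fin (y0 i)" if "i < N" for i
    unfolding ys_def y0_def yw_def
    using lowb_mono[OF lowb_shiftop[where d = d and \<phi> = \<phi>, OF L \<Delta>(2)[OF that]] LK]
      lowb_mono[OF lowb_shiftop[where d = d and \<phi> = \<phi>, OF ls0 \<Delta>(2)[OF that]] LK]
      lowb_shiftop[where d = d and \<phi> = \<phi>, OF lw \<Delta>(2)[OF that]] fin_shiftop[OF fs0] by auto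
  define a where "a i = words_pd Ps i y0" for i
  define Q where "Q = concat (map (\<lambda>(c, ws). map (\<lambda>(b, vs). (c * b, vs)) (taylor_rest N y0 ws)) Ps)"
  have taylor: "0 = words_eval Ps y0 + (\<Sum>i<N. a i * yw i) + words_eval Q yw"
    using words_eval_taylor[of Ps N y0 yw] Ps zero unfolding a_def Q_def ys_def[symmetric] ysum by auto
  have Qb: "fin b \<and> lowb (- (K * m)) b \<and> 2 \<le> length vs \<and> set vs \<subseteq> {..<N}" if bvs: "(b, vs) \<in> set Q" for b vs
  proof -
    obtain c ws b' where *: "(c, ws) \<in> set Ps" "(b', vs) \<in> set (taylor_rest N y0 ws)" "b = c * b'"
      using bvs unfolding Q_def by auto
    have b': "fin b' \<and> lowb (- (K * length ws)) b' \<and> 2 \<le> length vs \<and> set vs \<subseteq> {..<N}"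
      by (rule taylor_rest_bounds[OF K _ _ *(2)]) (use Ps[OF *(1)] lows in auto)
    have "lowb (0 + - (K * length ws)) b" unfolding *(3) using Ps[OF *(1)] b' by (intro lowb_mult) auto
    moreover have "- (K * m) \<le> 0 + - (K * length ws)" using m[OF *(1)] K by (simp add: mult_left_mono)
    moreover have "fin b" unfolding *(3) using Ps[OF *(1)] b' by (intro fin_mult) auto
    ultimately show ?thesis using b' lowb_mono by blast
  qed
  have fa: "fin (a i)" for i
    unfolding a_def words_pd_def
    by (rule fin_sum_list) (use Ps lows in \<open>force intro!: fin_mult fin_pd\<close>)
  \<comment> \<open>Passing from \<open>s\<close> to \<open>s0\<close> changes each argument only
    from order \<open>T - \<Delta>\<close> on; the shift by \<open>d i\<close> costs at most another
    \<open>\<Delta>\<close>.\<close>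
  have diffA: "lowb (T - 2 * \<Delta> - K * m) (A i - mon (- d i) * a i)" if i: "i < N" for i
  proof -
    have "lowb (T - \<Delta> - K * m) (c * (pd i ys ws - pd i y0 ws))" if cw: "(c, ws) \<in> set Ps" for c ws
    proof -
      have "lowb (T - \<Delta> - K * length ws) (pd i ys ws - pd i y0 ws)"
      proof (rule lowb_pd_diff[OF K])
        fix j assume "j \<in> set ws"
        then have "j < N" using Ps[OF cw] by auto
        then show "lowb (- K) (ys j) \<and> lowb (- K) (y0 j) \<and> lowb (T - \<Delta>) (ys j - y0 j)"
          using lows[of j] by (simp add: ysum)
      qed
      then have "lowb (0 + (T - \<Delta> - K * length ws)) (c * (pd i ys ws - pd i y0 ws))"
        using Ps[OF cw] by (intro lowb_mult) auto
      then show ?thesis using m[OF cw] K by (auto elim!: lowb_mono simp: mult_left_mono)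
    qed
    then have "lowb (T - \<Delta> - K * m) (\<Sum>(c, ws)\<leftarrow>Ps. c * (pd i ys ws - pd i y0 ws))"
      by (intro lowb_sum_list) auto
    also have "(\<Sum>(c, ws)\<leftarrow>Ps. c * (pd i ys ws - pd i y0 ws)) = words_pd Ps i ys - a i"
      unfolding a_def words_pd_def by (simp add: sum_list_subtractf right_diff_distrib case_prod_unfold)
    finally have "lowb (- d i + (T - \<Delta> - K * m)) (mon (- d i) * (words_pd Ps i ys - a i))"
      by (rule lowb_mon_mult)
    then show ?thesis unfolding A ys_def[symmetric] right_diff_distrib[symmetric]
      using \<Delta>(2)[OF i] by (auto elim!: lowb_mono)
  qed
  define \<alpha> where "\<alpha> i = gcoeff (A i) v" for i
  \<comment> \<open>Normalized linear coefficients: for \<open>i < N\<close> they consist of the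
    constant \<open>\<alpha> i\<close> and terms of positive exponent. Built from \<open>s0\<close>,
    they have finite support.\<close>
  define e where "e i = mon (- v - d i) * a i" for i
  have fe: "fin (e i)" for i unfolding e_def using fa by (intro fin_mult fin_mon)
  have e_coeff: "gcoeff (e i) t = gcoeff (A i) (t + v)" if "i < N" "t \<le> 0" for i t
  proof -
    have "gcoeff (A i - mon (- d i) * a i) (t + v) = 0"
      using diffA[OF that(1)] by (rule lowbD) (use that(2) T(4) in simp)
    moreover have "gcoeff (e i) t = gcoeff (a i) (t + v + d i)"
      unfolding e_def gcoeff_mon_mult by (rule arg_cong) simp
    ultimately show ?thesis by simp
  qed
  have epos: "0 < t" if "i < N" "gcoeff (e i - cst (\<alpha> i)) t \<noteq> 0" for i t
  proof (rule ccontr)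
    assume "\<not> 0 < t"
    then have "gcoeff (e i) t = (if t = 0 then \<alpha> i else 0)"
      using e_coeff[OF that(1), of t] lowbD[OF lowA[OF that(1)], of "t + v"] by (auto simp: \<alpha>_def)
    then show False using that(2) by (simp add: gcoeff_cst)
  qed
  define u where "u = mon (- T) * w"
  have w: "w = mon T * u" unfolding u_def mon_mult_assoc by (simp add: mon_0)
  have upos: "0 < \<mu>" if "gcoeff u \<mu> \<noteq> 0" for \<mu>
    using that unfolding u_def w_def trunc_gt_def by (auto split: if_splits)
  define \<psi> where "\<psi> i \<mu> = \<phi> i (\<mu> + T)" for i \<mu>
  define Z where "Z i = diag (\<psi> i) u" for i
  have yw: "yw i = mon (T - d i) * Z i" for i
    unfolding yw_def w shiftop_mon Z_def \<psi>_def ..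
  define q where "q \<mu> = p (\<mu> + T)" for \<mu>
  define Q' where "Q' = map (\<lambda>(b, vs). (- (mon (- v - T + (\<Sum>i\<leftarrow>vs. T - d i)) * b), vs)) Q"
  define R where "R = map (\<lambda>i. (cst (\<alpha> i) - e i, [i])) [0..<N]"
  define c0 where "c0 = - (mon (- v - T) * words_eval Ps y0)"
  have "0 = mon (- v - T) * (words_eval Ps y0 + (\<Sum>i<N. a i * yw i) + words_eval Q yw)"
    using taylor by simp
  also have "\<dots> = - c0 + (\<Sum>i<N. e i * Z i) - words_eval Q' Z"
  proof -
    have 1: "mon (- v - T) * (a i * yw i) = e i * Z i" for i
    proof -
      have "mon (- v - T) * (a i * yw i) = (mon (- v - T) * mon (T - d i)) * a i * Z i"
        by (simp add: yw ac_simps)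
      then show ?thesis by (simp add: mon_mult e_def)
    qed
    have 2: "mon (- v - T) * (b * wprod yw vs) = mon (- v - T + (\<Sum>i\<leftarrow>vs. T - d i)) * b * wprod Z vs" for b vs
    proof -
      have "wprod yw vs = mon (\<Sum>i\<leftarrow>vs. T - d i) * wprod Z vs"
        using wprod_mon[of "\<lambda>i. T - d i" Z vs] by (simp add: yw[abs_def])
      then show ?thesis by (simp add: mon_mult[symmetric] ac_simps)
    qed
    have 3: "mon (- v - T) * words_eval Q yw = - words_eval Q' Z"
      unfolding words_eval_def Q'_def
      by (simp add: 2 sum_list_const_mult[symmetric] comp_def case_prod_unfold uminus_sum_list_map)
    show ?thesis
      unfolding distrib_left sum_distrib_left 1 3 by (simp add: c0_def)
  qed
  finally have main: "(\<Sum>i<N. e i * Z i) = c0 + words_eval Q' Z" by (simp add: algebra_simps)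
  \<comment> \<open>The constant parts of the \<open>e i\<close> form a diagonal operator with
    symbol \<open>q\<close>, the divisor of the recursion; the remainders
    \<open>cst (\<alpha> i) - e i\<close> go to the right-hand side as perturbations.\<close>
  have "diag q u = (\<Sum>i<N. cst (\<alpha> i) * Z i)"
    by (rule gs_eqI) (simp add: q_def p Z_def \<psi>_def \<alpha>_def sum_distrib_right mult.assoc)
  also have "\<dots> = (\<Sum>i<N. (cst (\<alpha> i) - e i) * Z i) + (\<Sum>i<N. e i * Z i)"
    by (simp add: sum.distrib[symmetric] algebra_simps)
  also have "\<dots> = c0 + (words_eval R Z + words_eval Q' Z)"
    unfolding main by (simp add: R_def words_eval_def sum_list_lessThan comp_def)
  finally have eq: "diag q u = c0 + (words_eval R Z + words_eval Q' Z)" .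
  have Zpos: "0 < \<mu>" if "gcoeff (Z i) \<mu> \<noteq> 0" for i \<mu>
    using that upos by (auto simp: Z_def)
  have Zlow: "lowb 0 (wprod Z vs)" for vs
    using lowb_prod_list[of "map Z vs" 0] Zpos by (force simp: lowb_def)
  have RQ: "fin b \<and> set vs \<subseteq> {..<N} \<and> (\<forall>\<mu>. gcoeff b \<mu> \<noteq> 0 \<longrightarrow> 0 < \<mu>)" if "(b, vs) \<in> set (R @ Q')" for b vs
    using that unfolding set_append
  proof
    assume "(b, vs) \<in> set R"
    then obtain i where i: "i < N" "b = - (e i - cst (\<alpha> i))" "vs = [i]" by (auto simp: R_def)
    have "fin b" unfolding i(2) using fe by (intro fin_uminus fin_diff fin_cst)
    then show ?thesis using i epos[OF i(1)] by auto
  next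
    assume "(b, vs) \<in> set Q'"
    then obtain b' where b': "(b', vs) \<in> set Q" "b = - (mon (- v - T + (\<Sum>i\<leftarrow>vs. T - d i)) * b')"
      by (auto simp: Q'_def)
    note Qb = Qb[OF b'(1)]
    have "of_nat (length vs) * (T - \<Delta>) \<le> (\<Sum>i\<leftarrow>vs. T - d i)"
      using Qb \<Delta>(2) by (intro sum_list_le_length_mult) auto
    moreover have "2 * (T - \<Delta>) \<le> of_nat (length vs) * (T - \<Delta>)"
      using Qb T(3) by (intro mult_right_mono) auto
    ultimately have "0 < - v - T + (\<Sum>i\<leftarrow>vs. T - d i) + - (K * m)" using T(4) by simp
    moreover have "lowb (- v - T + (\<Sum>i\<leftarrow>vs. T - d i) + - (K * m)) b"
      unfolding b'(2) using Qb by (intro lowb_uminus lowb_mon_mult) auto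
    moreover have "fin b" unfolding b'(2) using Qb by (intro fin_uminus fin_mult fin_mon) auto
    ultimately show ?thesis using Qb unfolding lowb_def by (meson less_le_trans)
  qed
  have termpos: "0 < \<mu>" if "(b, vs) \<in> set (R @ Q')" "gcoeff (wprod Z vs * b) \<mu> \<noteq> 0" for b vs \<mu>
    using RQ[OF that(1)] by (intro gcoeff_positive_mult[OF Zlow _ that(2)]) auto
  have sumpos: "0 < \<mu>" if "gcoeff (words_eval (R @ Q') Z) \<mu> \<noteq> 0" for \<mu>
    using that unfolding words_eval_def
  proof (rule gcoeff_positive_sum)
    fix x \<mu> assume x: "x \<in> set (map (\<lambda>(c, ws). c * wprod Z ws) (R @ Q'))" "gcoeff x \<mu> \<noteq> 0"
    obtain b vs where "(b, vs) \<in> set (R @ Q')" "x = b * wprod Z vs"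
      using x(1) unfolding set_map by (auto simp del: set_append)
    then show "0 < \<mu>" using termpos[of b vs \<mu>] x(2) by (metis mult.commute)
  qed
  \<comment> \<open>No direct estimate of the residual at \<open>s0\<close> is made: every other
    term of the equation has positive exponents, so \<open>c0\<close> must have them too.\<close>
  have c0pos: "0 < \<mu>" if "gcoeff c0 \<mu> \<noteq> 0" for \<mu>
  proof (rule ccontr)
    assume "\<not> 0 < \<mu>"
    then have "gcoeff (diag q u) \<mu> = 0" "gcoeff (words_eval (R @ Q') Z) \<mu> = 0"
      using sumpos upos by auto
    then show False using that eq by (simp add: words_eval_def)
  qed
  have fc0: "fin c0"
    unfolding c0_def words_eval_def
  proof (intro fin_uminus fin_mult fin_mon fin_sum_list)
    fix x assume "x \<in> set (map (\<lambda>(c, ws). c * wprod y0 ws) Ps)"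
    then obtain c ws where cw: "(c, ws) \<in> set Ps" "x = c * wprod y0 ws" by auto
    show "fin x" unfolding cw(2) using Ps[OF cw(1)] lows(4) by (intro fin_mult fin_wprod) auto
  qed
  obtain r where r: "0 < r" "r < 1" "\<And>t. gnorm r t (diag q u) \<le> 1"
  proof (rule small_perturbation_bound[of u "{..<N}" \<psi> C q "(c0, []) # R @ Q'"])
    show "0 < \<mu>" if "gcoeff u \<mu> \<noteq> 0" for \<mu> using upos that .
    show "cmod (\<psi> i \<mu>) \<le> C * cmod (q \<mu>)" if "0 < \<mu>" "i \<in> {..<N}" for \<mu> i
      unfolding \<psi>_def q_def using that T(2) by (intro bound) auto
    show "diag q u = (\<Sum>(b, ws)\<leftarrow>(c0, []) # R @ Q'. b * wprod (\<lambda>i. diag (\<psi> i) u) ws)"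
      using eq by (simp add: words_eval_def Z_def[abs_def])
    show "fin b \<and> set ws \<subseteq> {..<N} \<and> (\<forall>\<mu>. gcoeff b \<mu> \<noteq> 0 \<longrightarrow> 0 < \<mu>)"
      if "(b, ws) \<in> set ((c0, []) # R @ Q')" for b ws
      using that RQ[of b ws] fc0 c0pos by auto
  qed (use \<open>0 \<le> C\<close> in auto)
  have u_bound: "gnorm r t u \<le> C" for t
  proof -
    have "gnorm r t (diag (\<lambda>_. 1) u) \<le> C * gnorm r t (diag q u)"
      using bound1 upos T(2) unfolding q_def by (intro gnorm_diag) force
    also have "\<dots> \<le> C * 1" using r(3) \<open>0 \<le> C\<close> by (intro mult_left_mono)
    also have "diag (\<lambda>_. 1) u = u" by (rule gs_eqI) simp
    finally show ?thesis by simp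
  qed
  have "(\<Sum>\<mu>\<in>U. cmod (gcoeff s \<mu>) * r powr \<mu>) \<le> C" if U: "finite U" "U \<subseteq> {T<..}" for U
  proof -
    obtain t where t: "\<And>\<mu>. \<mu> \<in> U \<Longrightarrow> \<mu> \<le> t" using U(1) by (meson bdd_above_finite bdd_above.E)
    have "(\<Sum>\<mu>\<in>U. cmod (gcoeff s \<mu>) * r powr \<mu>) = (\<Sum>\<mu>\<in>U. cmod (gcoeff w \<mu>) * r powr \<mu>)"
      using U(2) by (intro sum.cong) (auto simp: w_def trunc_gt_def)
    also have "\<dots> \<le> gnorm r t w" using U(1) t by (rule gnorm_ge_sum)
    also have "\<dots> \<le> gnorm r t (mon T) * gnorm r (t - T) u"
      unfolding w using gnorm_mult[OF r(1), of T "mon T" 0 u t] upos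
      by (force simp: lowb_def gcoeff_mon)
    also have "\<dots> \<le> 1 * C"
    proof (intro mult_mono u_bound)
      have "gnorm r t (mon T) \<le> (\<Sum>\<mu>\<in>{T}. 1)"
        unfolding gnorm_def using r T(1)
        by (intro sum_le_included[where i = id]) (auto simp: gcoeff_mon powr_le1)
      then show "gnorm r t (mon T) \<le> 1" by simp
    qed auto
    finally show ?thesis by simp
  qed
  then show ?thesis using r T(1) by blast
qed

section \<open>Symbols of the operators\<close>

primrec shft :: "oper \<Rightarrow> nat \<Rightarrow> real" where
  "shft Deriv = real"
| "shft Euler = (\<lambda>_. 0)"
| "shft (QDiff q) = (\<lambda>_. 0)"

text \<open>The factor picked up by x^mu is mu (mu - 1) ... (mu - i + 1) for the derivative, mu^i
  for Euler, and (q^mu)^i for the q-difference: each a polynomial of exact degree i, evaluated at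
  \<open>sbase\<close>.\<close>

primrec spoly :: "oper \<Rightarrow> nat \<Rightarrow> complex poly" where
  "spoly Deriv = (\<lambda>i. \<Prod>j<i. [:- of_nat j, 1:])"
| "spoly Euler = monom 1"
| "spoly (QDiff q) = monom 1"

primrec sbase :: "oper \<Rightarrow> real \<Rightarrow> complex" where
  "sbase Deriv = of_real"
| "sbase Euler = of_real"
| "sbase (QDiff q) = (\<lambda>\<mu>. q powr of_real \<mu>)"

definition symb :: "oper \<Rightarrow> nat \<Rightarrow> real \<Rightarrow> complex" where
  "symb D i \<mu> = poly (spoly D i) (sbase D \<mu>)"

lemma shft_nonneg: "0 \<le> shft D i"
  by (cases D) auto

lemma symb_0: "symb D 0 \<mu> = 1"
  by (cases D) (auto simp: symb_def poly_monom)

lemma degree_spoly: "degree (spoly D i) = i" and spoly_nonzero: "spoly D i \<noteq> 0"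
proof -
  have "degree (\<Prod>j<i. [:- of_nat j, 1:] :: complex poly) = i"
    by (subst degree_prod_eq_sum_degree) auto
  then show "degree (spoly D i) = i" by (cases D) (auto simp: degree_monom_eq)
  have "(\<Prod>j<i. [:- of_nat j, 1:]) \<noteq> (0 :: complex poly)" by simp
  then show "spoly D i \<noteq> 0" by (cases D) (auto simp: monom_eq_0_iff)
qed

lemma apply_oper_funpow:
  "(apply_oper D ^^ i) (gcoeff s) = gcoeff (shiftop (shft D) (symb D) s i)"
proof (induction i)
  case 0
  show ?case by (cases D) (auto simp: shiftop_def mon_0 symb_0 fun_eq_iff)
next
  case (Suc i)
  show ?case
  proof (cases D)
    case Deriv
    show ?thesis
    proof
      fix t
      have "(apply_oper D ^^ Suc i) (gcoeff s) t = apply_oper Deriv ((apply_oper D ^^ i) (gcoeff s)) t"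
        by (simp only: funpow.simps o_apply Deriv)
      also have "\<dots> = of_real (t + 1) * gcoeff (shiftop (shft D) (symb D) s i) (t + 1)"
        unfolding Suc by (simp only: apply_oper.simps)
      \<comment> \<open>The new factor \<open>t + 1\<close> is the last factor of the falling
        factorial, \<open>(t + 1 + i) - i\<close>.\<close>
      also have "\<dots> = symb D (Suc i) (t + 1 + i) * gcoeff s (t + 1 + i)"
        by (simp add: shiftop_def Deriv symb_def algebra_simps)
      also have "\<dots> = gcoeff (shiftop (shft D) (symb D) s (Suc i)) t"
      proof -
        have "t - - shft D (Suc i) = t + 1 + i" by (simp add: Deriv)
        then show ?thesis by (simp only: shiftop_def gcoeff_mon_mult gcoeff_diag)
      qed
      finally show "(apply_oper D ^^ Suc i) (gcoeff s) t = gcoeff (shiftop (shft D) (symb D) s (Suc i)) t" .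
    qed
  next
    case Euler
    then show ?thesis using Suc by (auto simp: shiftop_def symb_def poly_monom mon_0 fun_eq_iff)
  next
    case (QDiff q)
    then show ?thesis using Suc by (auto simp: shiftop_def symb_def poly_monom mon_0 fun_eq_iff)
  qed
qed

lemma norm_sbase_QDiff: "cmod (sbase (QDiff q) \<mu>) = cmod q powr \<mu>"
  by (simp add: norm_powr_real_powr')

text \<open>For the q-difference, |q^mu| = |q|^mu is strictly monotone in mu since |q| is not 1.
  Distinct indicial exponents thus become distinct roots of a polynomial.\<close>

lemma inj_sbase:
  assumes "valid_oper D"
  shows "inj (sbase D)"
proof (cases D)
  case (QDiff q)
  then have q: "0 < cmod q" "cmod q \<noteq> 1" using assms by (auto simp: valid_oper_def)
  show ?thesis
  proof (rule injI)
    fix \<mu> \<nu> assume "sbase D \<mu> = sbase D \<nu>"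
    then have "cmod q powr \<mu> = cmod q powr \<nu>" using QDiff norm_sbase_QDiff by metis
    then show "\<mu> = \<nu>" using q by (metis powr_inj less_irrefl)
  qed
qed (auto simp: inj_def)

lemma poly_quotient_tendsto:
  fixes f g :: "complex poly"
  assumes "degree f \<le> degree g" "g \<noteq> 0"
  shows "\<exists>L. ((\<lambda>x. poly f x / poly g x) \<longlongrightarrow> L) at_infinity"
proof (cases "degree f < degree g")
  case True
  then show ?thesis using poly_divide_tendsto_0_at_infinity by blast
next
  case False
  then have deg: "degree f = degree g" using assms(1) by simp
  have "((\<lambda>x. (poly f x / x ^ degree f) / (poly g x / x ^ degree g)) \<longlongrightarrow> lead_coeff f / lead_coeff g) at_infinity"
    using assms(2) by (intro tendsto_divide poly_divide_tendsto_aux) auto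
  moreover have eq: "\<forall>\<^sub>F x in at_infinity.
      (poly f x / x ^ degree f) / (poly g x / x ^ degree g) = poly f x / poly g x"
    by (rule eventually_at_infinityI[of 1]) (auto simp: deg)
  ultimately show ?thesis unfolding tendsto_cong[OF eq] by blast
qed

text \<open>The symbols have pairwise distinct degrees, so the leading term of the largest index
  with nonzero coefficient cannot cancel.\<close>

lemma spoly_comb_nonzero:
  assumes "i < N" "c i \<noteq> 0"
  shows "(\<Sum>i<N. smult (c i) (spoly D i)) \<noteq> 0"
proof -
  let ?I = "{i. i < N \<and> c i \<noteq> 0}"
  define k where "k = Max ?I"
  have "k \<in> ?I" unfolding k_def by (rule Max_in) (use assms in auto)
  then have k: "k < N" "c k \<noteq> 0" by auto
  have above: "c j = 0" if "j < N" "k < j" for j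
  proof (rule ccontr)
    assume "c j \<noteq> 0"
    then have "j \<le> k" unfolding k_def using that by (intro Max_ge) auto
    then show False using that by simp
  qed
  have "coeff (\<Sum>i<N. smult (c i) (spoly D i)) k = (\<Sum>i<N. c i * coeff (spoly D i) k)"
    by (simp add: coeff_sum)
  also have "\<dots> = (\<Sum>i\<in>{k}. c i * coeff (spoly D i) k)"
  proof (rule sum.mono_neutral_right)
    show "\<forall>i\<in>{..<N} - {k}. c i * coeff (spoly D i) k = 0"
    proof
      fix i assume "i \<in> {..<N} - {k}"
      then consider "i < k" | "k < i" "i < N" by fastforce
      then show "c i * coeff (spoly D i) k = 0"
        using above by cases (auto simp: coeff_eq_0 degree_spoly)
    qed
  qed (use k in auto)
  also have "\<dots> \<noteq> 0"
    using k spoly_nonzero[of D k] leading_coeff_0_iff[of "spoly D k"] by (simp add: degree_spoly)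
  finally show ?thesis by auto
qed

text \<open>Having \<open>n\<close> distinct zeros forces the polynomial of degree at most \<open>n\<close> in \<open>sbase D\<close> to have
  full degree and, in the \<open>q\<close>-case with \<open>|q| < 1\<close>, nonzero constant coefficient, since
  \<open>q\<^sup>\<mu> \<noteq> 0\<close>.\<close>
lemma symbols_dominated:
  fixes c :: "nat \<Rightarrow> complex"
  assumes D: "valid_oper D"
    and p: "\<And>\<mu>. p \<mu> = (\<Sum>i<Suc n. c i * symb D i \<mu>)"
    and c: "i0 < Suc n" "c i0 \<noteq> 0"
    and Z: "finite {\<rho>. p \<rho> = 0} \<Longrightarrow> n \<le> card {\<rho>. p \<rho> = 0}"
  shows "\<exists>C T0. 0 \<le> C \<and> (\<forall>\<mu>>T0. \<forall>i<Suc n. cmod (symb D i \<mu>) \<le> C * cmod (p \<mu>))"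
proof -
  define G where "G = (\<Sum>i<Suc n. smult (c i) (spoly D i))"
  have pG: "p \<mu> = poly G (sbase D \<mu>)" for \<mu>
    unfolding p G_def symb_def by (simp only: poly_sum poly_smult)
  have G0: "G \<noteq> 0" unfolding G_def by (rule spoly_comb_nonzero[of i0]) (use c in auto)
  have degG: "degree G \<le> n"
    unfolding G_def by (rule degree_sum_le) (auto simp: degree_spoly intro: order_trans[OF degree_smult_le])
  let ?Z = "{\<rho>. p \<rho> = 0}"
  have inj: "inj_on (sbase D) A" for A using inj_sbase[OF D] by (rule inj_on_subset) simp
  have sub: "sbase D ` ?Z \<subseteq> {z. poly G z = 0}" by (auto simp: pG)
  have finZ: "finite ?Z"
    using finite_subset[OF sub poly_roots_finite[OF G0]] finite_image_iff[OF inj] by blast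
  have cardZ: "card ?Z = card (sbase D ` ?Z)" by (rule card_image[OF inj, symmetric])
  have deg: "degree G = n"
    using Z[OF finZ] cardZ card_mono[OF poly_roots_finite[OF G0] sub] card_poly_roots_bound[OF G0] degG by linarith
  have ev_nz: "\<forall>\<^sub>F \<mu> in at_top. p \<mu> \<noteq> 0"
    using eventually_gt_at_top[of "Max ?Z"]
  proof eventually_elim
    case (elim \<mu>)
    then show ?case using Max_ge[OF finZ, of \<mu>] by force
  qed
  have lim: "\<exists>L. ((\<lambda>\<mu>. symb D i \<mu> / p \<mu>) \<longlongrightarrow> L) at_top" if i: "i < Suc n" for i
  \<comment> \<open>This fails only for the q-difference with |q| < 1. There \<open>sbase D\<close>
    tends to 0, and the limit is a quotient of constant coefficients rather than one governed by the
    coefficients of degree \<open>n\<close>.\<close>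
  proof (cases "filterlim (sbase D) at_infinity at_top")
    case True
    obtain L where "((\<lambda>x. poly (spoly D i) x / poly G x) \<longlongrightarrow> L) at_infinity"
      using poly_quotient_tendsto[OF _ G0, of "spoly D i"] deg degree_spoly[of D i] i by force
    from filterlim_compose[OF this True] show ?thesis unfolding symb_def pG by blast
  next
    case False
    obtain q where q: "D = QDiff q"
      using False by (cases D) (auto intro: filterlim_of_real_at_infinity)
    have q0: "0 < cmod q" "cmod q \<noteq> 1" using D q by (auto simp: valid_oper_def)
    have norm: "cmod (sbase D \<mu>) = exp (\<mu> * ln (cmod q))" for \<mu>
      using q0 by (simp add: q norm_sbase_QDiff powr_def)
    have "\<not> 1 < cmod q"
    proof
      assume "1 < cmod q"
      then have "0 < ln (cmod q)" by (rule ln_gt_zero)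
      then have "filterlim (\<lambda>\<mu>. exp (\<mu> * ln (cmod q))) at_top at_top"
        by (intro filterlim_compose[OF exp_at_top] filterlim_at_top_mult_tendsto_pos[where c = "ln (cmod q)"]
            tendsto_const filterlim_ident) auto
      then have "filterlim (sbase D) at_infinity at_top"
        by (intro filterlim_norm_at_top_imp_at_infinity) (simp add: norm)
      then show False using False by simp
    qed
    then have "ln (cmod q) < 0" using q0 by simp
    then have "filterlim (\<lambda>\<mu>. ln (cmod q) * \<mu>) at_bot at_top"
      by (intro filterlim_tendsto_neg_mult_at_bot[OF tendsto_const _ filterlim_ident])
    from filterlim_compose[OF exp_at_bot this]
    have "((\<lambda>\<mu>. exp (\<mu> * ln (cmod q))) \<longlongrightarrow> 0) at_top"
      by (simp add: mult.commute)
    then have "((\<lambda>\<mu>. cmod (sbase D \<mu>)) \<longlongrightarrow> 0) at_top" by (simp only: norm)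
    then have to0: "(sbase D \<longlongrightarrow> 0) at_top" by (rule tendsto_norm_zero_cancel)
    have "poly G 0 \<noteq> 0"
    proof
      assume "poly G 0 = 0"
      then have "insert 0 (sbase D ` ?Z) \<subseteq> {z. poly G z = 0}" using sub by simp
      then have "card (insert 0 (sbase D ` ?Z)) \<le> n"
        using order_trans[OF card_mono[OF poly_roots_finite[OF G0]] card_poly_roots_bound[OF G0]] deg
        by blast
      moreover have "0 \<notin> sbase D ` ?Z" using norm by (metis exp_not_eq_zero imageE norm_zero)
      ultimately have "Suc (card ?Z) \<le> n" using finZ cardZ by simp
      then show False using Z[OF finZ] by simp
    qed
    then have "((\<lambda>\<mu>. poly (spoly D i) (sbase D \<mu>) / poly G (sbase D \<mu>)) \<longlongrightarrow> poly (spoly D i) 0 / poly G 0) at_top"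
      by (intro tendsto_divide tendsto_poly to0)
    then show ?thesis unfolding symb_def pG by blast
  qed
  have "\<exists>C. \<forall>\<^sub>F \<mu> in at_top. cmod (symb D i \<mu>) \<le> C * cmod (p \<mu>)" if i: "i < Suc n" for i
  proof -
    obtain L where L: "((\<lambda>\<mu>. symb D i \<mu> / p \<mu>) \<longlongrightarrow> L) at_top" using lim[OF i] by blast
    have "\<forall>\<^sub>F \<mu> in at_top. cmod (symb D i \<mu> / p \<mu>) < cmod L + 1"
      using tendsto_norm[OF L] by (rule order_tendstoD) simp
    then have "\<forall>\<^sub>F \<mu> in at_top. cmod (symb D i \<mu>) \<le> (cmod L + 1) * cmod (p \<mu>)"
      using ev_nz
    proof eventually_elim
      case (elim \<mu>)
      then show ?case by (simp add: norm_divide divide_less_eq)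
    qed
    then show ?thesis by blast
  qed
  then obtain C where C: "\<And>i. i < Suc n \<Longrightarrow> \<forall>\<^sub>F \<mu> in at_top. cmod (symb D i \<mu>) \<le> C i * cmod (p \<mu>)"
    by metis
  define C' where "C' = (\<Sum>i<Suc n. \<bar>C i\<bar>)"
  have "\<forall>\<^sub>F \<mu> in at_top. \<forall>i\<in>{..<Suc n}. cmod (symb D i \<mu>) \<le> C i * cmod (p \<mu>)"
    using C by (intro eventually_ball_finite) auto
  then have "\<forall>\<^sub>F \<mu> in at_top. \<forall>i<Suc n. cmod (symb D i \<mu>) \<le> C' * cmod (p \<mu>)"
  proof eventually_elim
    case (elim \<mu>)
    show ?case
    proof (intro allI impI)
      fix i assume i: "i < Suc n"
      have "C i \<le> \<bar>C i\<bar>" by simp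
      also have "\<bar>C i\<bar> \<le> C'" unfolding C'_def using i by (intro member_le_sum) auto
      finally have "C i * cmod (p \<mu>) \<le> C' * cmod (p \<mu>)" by (rule mult_right_mono) simp
      then show "cmod (symb D i \<mu>) \<le> C' * cmod (p \<mu>)" using elim i by force
    qed
  qed
  then obtain T0 where "\<forall>\<mu>>T0. \<forall>i<Suc n. cmod (symb D i \<mu>) \<le> C' * cmod (p \<mu>)"
    by (auto simp: eventually_at_top_dense)
  moreover have "0 \<le> C'" unfolding C'_def by (intro sum_nonneg) simp
  ultimately show ?thesis by blast
qed

section \<open>Rational functionals\<close>

interpretation Q: vector_space "\<lambda>(q::rat) (x::real). of_rat q * x"
  by unfold_locales (simp_all add: algebra_simps of_rat_add of_rat_mult)

interpretation QQ: vector_space_pair "\<lambda>(q::rat) (x::real). of_rat q * x" "\<lambda>(q::rat) (x::real). of_rat q * x"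
  ..

lemma rat_span_eq: "rat_span E = Q.span E"
  unfolding rat_span_def Q.span_explicit by auto

text \<open>A Hamel basis argument: \<open>b\<close> stays independent of a basis of the span, so
  the values 1 at \<open>b\<close> and 0 on that basis extend linearly over Q. Additivity is the
  property that \<open>diag_mult\<close> asks for.\<close>

lemma rational_functional:
  assumes "b \<notin> Q.span X"
  obtains l :: "real \<Rightarrow> real" where "\<And>u v. l (u + v) = l u + l v" "\<And>x. x \<in> Q.span X \<Longrightarrow> l x = 0" "l b = 1"
proof -
  obtain B where B: "B \<subseteq> X" "Q.independent B" "X \<subseteq> Q.span B"
    by (rule Q.maximal_independent_subset)
  have span: "Q.span X = Q.span B"
    using Q.span_minimal[OF B(3) Q.subspace_span] Q.span_mono[OF B(1)] by blast
  have ind: "Q.independent (insert b B)" using B(2) assms span by (intro Q.independent_insertI) auto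
  obtain l where l: "Vector_Spaces.linear (\<lambda>(q::rat) (x::real). of_rat q * x) (\<lambda>(q::rat) (x::real). of_rat q * x) l"
      "\<forall>x\<in>insert b B. l x = (if x = b then 1 else 0)"
    using QQ.linear_independent_extend[OF ind, of "\<lambda>x. if x = b then 1 else 0"] by blast
  interpret l: Vector_Spaces.linear "\<lambda>(q::rat) (x::real). of_rat q * x" "\<lambda>(q::rat) (x::real). of_rat q * x" l
    by (rule l(1))
  have "b \<notin> B" using assms span Q.span_base by auto
  then have "l x = 0" if "x \<in> B" for x using l(2) that by auto
  then have "l x = 0" if "x \<in> Q.span B" for x
    using that by (rule l.eq_0_on_span)
  then show ?thesis using that[of l] l(2) span l.add by auto
qed

text \<open>The set \<open>U\<close> holds what a functional has to kill besides the earlier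
  exponents. It will be \<open>{1}\<close>, or empty when neither the coefficients nor the shifts
  involve a nonzero exponent.\<close>

definition jumps :: "real set \<Rightarrow> real set \<Rightarrow> real set" where
  "jumps U S = {b \<in> S. b \<notin> Q.span (U \<union> {\<mu> \<in> S. \<mu> < b})}"

text \<open>Induction on the finite number of smaller exponents: one that is no jump lies in the
  span of \<open>U\<close> and earlier exponents, which are already covered.\<close>

lemma jumps_span:
  assumes "\<And>t. finite {\<mu> \<in> S. \<mu> \<le> t}"
  shows "S \<subseteq> Q.span (U \<union> jumps U S)"
proof
  fix b assume "b \<in> S"
  then show "b \<in> Q.span (U \<union> jumps U S)"
  proof (induction "card {\<mu> \<in> S. \<mu> < b}" arbitrary: b rule: less_induct)
    case (less b)
    have fin: "finite {\<mu> \<in> S. \<mu> < c}" for c by (rule finite_subset[OF _ assms[of c]]) auto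
    show ?case
    proof (cases "b \<in> jumps U S")
      case True
      then show ?thesis by (simp add: Q.span_base)
    next
      case False
      have "\<mu> \<in> Q.span (U \<union> jumps U S)" if \<mu>: "\<mu> \<in> S" "\<mu> < b" for \<mu>
      proof (rule less.hyps[OF _ \<mu>(1)])
        have "{\<nu> \<in> S. \<nu> < \<mu>} \<subset> {\<nu> \<in> S. \<nu> < b}" using \<mu> by force
        then show "card {\<nu> \<in> S. \<nu> < \<mu>} < card {\<nu> \<in> S. \<nu> < b}" by (rule psubset_card_mono[OF fin])
      qed
      then have "U \<union> {\<mu> \<in> S. \<mu> < b} \<subseteq> Q.span (U \<union> jumps U S)"
        by (auto intro: Q.span_base)
      then have "Q.span (U \<union> {\<mu> \<in> S. \<mu> < b}) \<subseteq> Q.span (U \<union> jumps U S)"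
        by (rule Q.span_minimal[OF _ Q.subspace_span])
      then show ?thesis using False less.prems by (auto simp: jumps_def)
    qed
  qed
qed

text \<open>The exchange lemma against the spanning set \<open>U\<close> plus jumps. The summand
  \<open>card U\<close> is the loss that the root count has to recover.\<close>

lemma card_le_jumps:
  assumes "\<And>t. finite {\<mu> \<in> S. \<mu> \<le> t}" "finite (jumps U S)" "finite U"
    "Q.independent B" "B \<subseteq> S \<union> Q.span U"
  shows "card B \<le> card U + card (jumps U S)"
proof -
  have "B \<subseteq> Q.span (U \<union> jumps U S)"
    using assms(5) jumps_span[OF assms(1)] Q.span_mono[of U "U \<union> jumps U S"] by blast
  then have "card B \<le> card (U \<union> jumps U S)"
    using Q.independent_span_bound[of "U \<union> jumps U S" B] assms(2,3,4) by simp
  then show ?thesis using card_Un_le[of U "jumps U S"] by linarith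
qed

lemma indep_mod_independent:
  assumes "finite B" "indep_mod W B" "0 \<in> W"
  shows "Q.independent B"
  unfolding Q.dependent_finite[OF assms(1)] using assms(2,3) by (auto simp: indep_mod_def)

text \<open>A combination of \<open>B\<close> equal to 1 would lie in the span of 1 and so have zero
  coefficients. The adjoined 1 offsets \<open>card {1}\<close> in
  \<open>card_le_jumps\<close>.\<close>

lemma indep_mod_insert:
  assumes "finite B" "indep_mod (Q.span {1}) B"
  shows "Q.independent (insert 1 B)" "1 \<notin> B"
proof -
  have ind: "Q.independent B" using indep_mod_independent[OF assms] Q.span_zero by blast
  have "1 \<notin> Q.span B"
  proof
    assume "1 \<in> Q.span B"
    then obtain c where c: "1 = (\<Sum>b\<in>B. of_rat (c b) * b)"
      unfolding Q.span_finite[OF assms(1)] by auto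
    moreover have "(1::real) \<in> Q.span {1}" by (simp add: Q.span_base)
    ultimately have "\<forall>b\<in>B. c b = 0" using assms(2) unfolding indep_mod_def by metis
    then show False using c by simp
  qed
  then show "Q.independent (insert 1 B)" "1 \<notin> B"
    using ind Q.independent_insertI Q.span_base by auto
qed

text \<open>Since \<open>cis\<close> has modulus 1, the majorant does not depend on the angle;
  beyond \<open>T\<close>, where exponents are positive, it is valid at every radius below
  \<open>r\<close>.\<close>

lemma uniform_limit_gpartial:
  assumes s: "is_gser s" and T: "0 \<le> T"
    and bound: "\<And>U. finite U \<Longrightarrow> U \<subseteq> {T<..} \<Longrightarrow> (\<Sum>\<mu>\<in>U. cmod (s \<mu>) * r powr \<mu>) \<le> C"
  shows "\<exists>f. uniform_limit (sector r \<theta> \<beta>) (gpartial s) f at_top"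
proof -
  define X where "X = {\<mu>. T < \<mu> \<and> s \<mu> \<noteq> 0}"
  define g where "g = (\<lambda>\<mu> (r, \<theta>). s \<mu> * of_real (r powr \<mu>) * cis (\<mu> * \<theta>))"
  define F where "F t = {\<mu>. T < \<mu> \<and> \<mu> \<le> t \<and> s \<mu> \<noteq> 0}" for t
  have lim: "uniform_limit (sector r \<theta> \<beta>) (\<lambda>A y. \<Sum>\<mu>\<in>A. g \<mu> y) (\<lambda>y. \<Sum>\<^sub>\<infinity>\<mu>\<in>X. g \<mu> y)
      (finite_subsets_at_top X)"
  proof (rule Weierstrass_m_test_general[where M = "\<lambda>\<mu>. cmod (s \<mu>) * r powr \<mu>"])
    fix \<mu> y assume \<mu>: "\<mu> \<in> X" and y: "y \<in> sector r \<theta> \<beta>"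
    obtain r' \<theta>' where y': "y = (r', \<theta>')" "0 < r'" "r' < r" using y by (auto simp: sector_def)
    have "r' powr \<mu> \<le> r powr \<mu>" using y' \<mu> T by (intro powr_mono2) (auto simp: X_def)
    then show "cmod (g \<mu> y) \<le> cmod (s \<mu>) * r powr \<mu>"
      using y' by (simp add: g_def norm_mult mult_left_mono)
  next
    have "sum (\<lambda>\<mu>. cmod (s \<mu>) * r powr \<mu>) A \<le> C" if "A \<subseteq> X" "finite A" for A
      using that by (intro bound) (auto simp: X_def)
    then show "(\<lambda>\<mu>. cmod (s \<mu>) * r powr \<mu>) summable_on X"
      by (intro nonneg_bdd_above_summable_on bdd_aboveI[where M = C]) auto
  qed
  \<comment> \<open>The Weierstrass test produces an unordered sum; the cut-offs \<open>F t\<close>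
    eventually contain every finite part of \<open>X\<close>, which turns it into summation by
    increasing exponents.\<close>
  have F_lim: "filterlim F (finite_subsets_at_top X) at_top"
    unfolding filterlim_finite_subsets_at_top
  proof (intro allI impI)
    fix Y assume Y: "finite Y \<and> Y \<subseteq> X"
    obtain t0 where t0: "\<And>\<mu>. \<mu> \<in> Y \<Longrightarrow> \<mu> \<le> t0" using Y by (meson bdd_above_finite bdd_above.E)
    show "\<forall>\<^sub>F t in at_top. finite (F t) \<and> Y \<subseteq> F t \<and> F t \<subseteq> X"
      using eventually_ge_at_top[of t0]
    proof eventually_elim
      case (elim t)
      have "finite (F t)" by (rule finite_subset[OF _ gser_finite[OF s, of t]]) (auto simp: F_def)
      moreover have "Y \<subseteq> F t" using Y t0 elim by (force simp: X_def F_def)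
      ultimately show ?case by (auto simp: X_def F_def)
    qed
  qed
  have "uniform_limit (sector r \<theta> \<beta>) (\<lambda>t y. \<Sum>\<mu>\<in>F t. g \<mu> y) (\<lambda>y. \<Sum>\<^sub>\<infinity>\<mu>\<in>X. g \<mu> y) at_top"
    using filterlim_compose[OF lim F_lim] by simp
  \<comment> \<open>The head up to \<open>T\<close> may contain negative exponents and be unbounded
    near the origin, but it is common to all later partial sums and so leaves uniformity
    intact.\<close>
  then have "uniform_limit (sector r \<theta> \<beta>) (\<lambda>t y. gpartial s T y + (\<Sum>\<mu>\<in>F t. g \<mu> y))
      (\<lambda>y. gpartial s T y + (\<Sum>\<^sub>\<infinity>\<mu>\<in>X. g \<mu> y)) at_top"
    by (intro uniform_limit_add uniform_limit_const)
  moreover have eq: "\<forall>\<^sub>F t in at_top. \<forall>y\<in>sector r \<theta> \<beta>. gpartial s T y + (\<Sum>\<mu>\<in>F t. g \<mu> y) = gpartial s t y"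
    using eventually_ge_at_top[of T]
  proof eventually_elim
    case (elim t)
    have split: "{\<mu>. \<mu> \<le> t \<and> s \<mu> \<noteq> 0} = {\<mu>. \<mu> \<le> T \<and> s \<mu> \<noteq> 0} \<union> F t" using elim by (auto simp: F_def)
    have "finite (F t)" by (rule finite_subset[OF _ gser_finite[OF s, of t]]) (auto simp: F_def)
    moreover have "{\<mu>. \<mu> \<le> T \<and> s \<mu> \<noteq> 0} \<inter> F t = {}" by (auto simp: F_def)
    ultimately have "(\<Sum>\<mu> | \<mu> \<le> t \<and> s \<mu> \<noteq> 0. g \<mu> y) = (\<Sum>\<mu> | \<mu> \<le> T \<and> s \<mu> \<noteq> 0. g \<mu> y) + (\<Sum>\<mu>\<in>F t. g \<mu> y)" for y
      unfolding split using gser_finite[OF s, of T] by (intro sum.union_disjoint) auto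
    moreover have "gpartial s t' y = (\<Sum>\<mu> | \<mu> \<le> t' \<and> s \<mu> \<noteq> 0. g \<mu> y)" for t' y
      by (cases y) (simp add: gpartial_def g_def)
    ultimately show ?case by simp
  qed
  ultimately show ?thesis by (auto simp: uniform_limit_cong[OF eq])
qed

section \<open>Polynomials and their partial derivatives\<close>

lemma poly_gser_nonzeroD: "poly_gser p t \<noteq> 0 \<Longrightarrow> \<exists>k. t = real k \<and> coeff p k \<noteq> 0"
  unfolding poly_gser_def by metis

lift_definition pg :: "complex poly \<Rightarrow> gs" is poly_gser
proof (rule is_gser_finite)
  fix p :: "complex poly"
  have "{\<mu>. poly_gser p \<mu> \<noteq> 0} \<subseteq> real ` {..degree p}"
    using poly_gser_nonzeroD le_degree by blast
  then show "finite {\<mu>. poly_gser p \<mu> \<noteq> 0}" using finite_subset by blast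
qed

lemma gcoeff_pg_nonzeroD: "gcoeff (pg p) t \<noteq> 0 \<Longrightarrow> \<exists>k. t = real k \<and> coeff p k \<noteq> 0"
  by (simp add: pg.rep_eq poly_gser_nonzeroD)

lemma gcoeff_pg: "gcoeff (pg p) (real k) = coeff p k"
  by (simp add: pg.rep_eq poly_gser_def)

lemma fin_pg: "fin (pg p)"
  unfolding fin_def by (rule finite_subset[of _ "real ` {..degree p}"]) (auto dest: gcoeff_pg_nonzeroD intro: le_degree)

lemma lowb_pg: "lowb 0 (pg p)"
  unfolding lowb_def by (auto dest: gcoeff_pg_nonzeroD)

lemma pg_nonzero: "p \<noteq> 0 \<Longrightarrow> pg p \<noteq> 0"
  using gcoeff_pg[of p] by (metis gcoeff_0 leading_coeff_0_iff)

lemma gcoeff_of_nat_mult: "gcoeff (of_nat k * a) t = of_nat k * gcoeff a t"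
  by (induction k) (auto simp: algebra_simps)

lemma pg_smult_of_nat: "pg (smult (of_nat k) p) = of_nat k * pg p"
proof (rule gs_eqI)
  fix t show "gcoeff (pg (smult (of_nat k) p)) t = gcoeff (of_nat k * pg p) t"
    by (simp add: gcoeff_of_nat_mult pg.rep_eq poly_gser_def)
qed

section \<open>Exponent vectors, words and formal partial derivatives\<close>

definition mpow :: "nat \<Rightarrow> (nat \<Rightarrow> gs) \<Rightarrow> nat list \<Rightarrow> gs" where
  "mpow N y \<alpha> = (\<Prod>i<N. y i ^ (\<alpha> ! i))"

definition deval :: "nat \<Rightarrow> (nat list \<Rightarrow> complex poly) \<Rightarrow> (nat \<Rightarrow> gs) \<Rightarrow> gs" where
  "deval n P y = (\<Sum>\<alpha> | P \<alpha> \<noteq> 0. pg (P \<alpha>) * mpow (Suc n) y \<alpha>)"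

lemma gpow_gcoeff: "gpow (gcoeff a) k = gcoeff (a ^ k)"
  by (induction k) (simp_all add: gpow_def one_gs.rep_eq times_gs.rep_eq)

lemma gprod_list_gcoeff: "gprod_list (map (\<lambda>i. gcoeff (f i)) xs) = gcoeff (prod_list (map f xs))"
  by (induction xs) (simp_all add: gprod_list_def one_gs.rep_eq times_gs.rep_eq)

lemma eval_dpoly_gcoeff:
  "eval_dpoly D n P (gcoeff s) = gcoeff (deval n P (shiftop (shft D) (symb D) s))"
proof
  fix t
  let ?y = "shiftop (shft D) (symb D) s"
  have "gprod_list (map (\<lambda>i. gpow ((apply_oper D ^^ i) (gcoeff s)) (\<alpha> ! i)) [0..<Suc n]) =
      gcoeff (mpow (Suc n) ?y \<alpha>)" for \<alpha>
    unfolding apply_oper_funpow gpow_gcoeff gprod_list_gcoeff mpow_def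
    using prod.distinct_set_conv_list[of "[0..<Suc n]" "\<lambda>i. ?y i ^ (\<alpha> ! i)"]
    by (simp add: atLeast0LessThan del: upt_Suc)
  then show "eval_dpoly D n P (gcoeff s) t = gcoeff (deval n P ?y) t"
    unfolding eval_dpoly_def deval_def by (simp add: times_gs.rep_eq pg.rep_eq)
qed

definition exp_word :: "nat \<Rightarrow> nat list \<Rightarrow> nat list" where
  "exp_word N \<alpha> = concat (map (\<lambda>i. replicate (\<alpha> ! i) i) [0..<N])"

lemma set_exp_word: "set (exp_word N \<alpha>) \<subseteq> {..<N}"
  by (auto simp: exp_word_def)

lemma count_list_replicate: "count_list (replicate k x) y = (if x = y then k else 0)"
  by (induction k) auto

lemma count_list_exp_word: "count_list (exp_word N \<alpha>) j = (if j < N then \<alpha> ! j else 0)"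
  by (induction N) (auto simp: exp_word_def count_list_replicate)

lemma wprod_count:
  assumes "set ws \<subseteq> {..<N}"
  shows "wprod y ws = (\<Prod>i<N. y i ^ count_list ws i)"
  using assms
proof (induction ws)
  case (Cons j ws)
  have "(\<Prod>i<N. y i ^ count_list (j # ws) i) = (\<Prod>i<N. (if i = j then y i else 1) * y i ^ count_list ws i)"
    by (intro prod.cong) auto
  also have "\<dots> = y j * wprod y ws" using Cons by (simp add: prod.distrib)
  finally show ?case by simp
qed simp

lemma wprod_remove1: "i \<in> set ws \<Longrightarrow> y i * wprod y (remove1 i ws) = wprod y ws"
  by (induction ws) (auto simp: mult.left_commute)

text \<open>The product rule in \<open>pd\<close> deletes each occurrence of \<open>i\<close> in
  turn, and by commutativity all these deletions give the same monomial.\<close>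

lemma pd_count: "pd i y ws = of_nat (count_list ws i) * wprod y (remove1 i ws)"
proof (induction ws)
  case (Cons j ws)
  show ?case
  proof (cases "i = j \<and> i \<in> set ws")
    case True
    then have "wprod y ws = y j * wprod y (remove1 j ws)" using wprod_remove1 by metis
    then show ?thesis using True Cons by (simp add: algebra_simps)
  next
    case False
    then show ?thesis using Cons by (auto simp: algebra_simps count_list_0_iff)
  qed
qed simp

lemma wprod_exp_word: "wprod y (exp_word N \<alpha>) = mpow N y \<alpha>"
  using wprod_count[OF set_exp_word] by (simp add: mpow_def count_list_exp_word)

lemma pd_exp_word:
  assumes "i < N" "length \<alpha> = N"
  shows "pd i y (exp_word N \<alpha>) = of_nat (\<alpha> ! i) * mpow N y (\<alpha>[i := \<alpha> ! i - 1])"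
proof -
  have "set (remove1 i (exp_word N \<alpha>)) \<subseteq> {..<N}" using set_exp_word set_remove1_subset by (meson order_trans)
  then have "wprod y (remove1 i (exp_word N \<alpha>)) = (\<Prod>j<N. y j ^ count_list (remove1 i (exp_word N \<alpha>)) j)"
    by (rule wprod_count)
  also have "\<dots> = mpow N y (\<alpha>[i := \<alpha> ! i - 1])"
    unfolding mpow_def using assms by (intro prod.cong) (auto simp: count_list_exp_word nth_list_update)
  finally show ?thesis using assms by (simp add: pd_count count_list_exp_word)
qed

text \<open>The coefficient at \<open>\<beta>\<close> comes from the exponent vector raised by one
  in place \<open>i\<close>. Without the length test an out-of-range update would leave
  \<open>\<beta>\<close> unchanged and produce a spurious multiple of
  \<open>P \<beta>\<close>.\<close>

definition dpd :: "nat \<Rightarrow> (nat list \<Rightarrow> complex poly) \<Rightarrow> nat list \<Rightarrow> complex poly" where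
  "dpd i P \<beta> = (if i < length \<beta> then smult (of_nat (Suc (\<beta> ! i))) (P (\<beta>[i := Suc (\<beta> ! i)])) else 0)"

lemma dpd_nonzero: "dpd i P \<beta> \<noteq> 0 \<longleftrightarrow> i < length \<beta> \<and> P (\<beta>[i := Suc (\<beta> ! i)]) \<noteq> 0"
  by (simp add: dpd_def del: of_nat_Suc)

lemma dpd_lower:
  assumes "i < length \<alpha>" "0 < \<alpha> ! i"
  shows "dpd i P (\<alpha>[i := \<alpha> ! i - 1]) = smult (of_nat (\<alpha> ! i)) (P \<alpha>)"
  using assms by (simp add: dpd_def)

lemma is_dpoly_dpd:
  assumes "is_dpoly n P"
  shows "is_dpoly n (dpd i P)"
  unfolding is_dpoly_def
proof
  have "{\<beta>. dpd i P \<beta> \<noteq> 0} \<subseteq> (\<lambda>\<alpha>. \<alpha>[i := \<alpha> ! i - 1]) ` {\<alpha>. P \<alpha> \<noteq> 0}"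
  proof
    fix \<beta> assume "\<beta> \<in> {\<beta>. dpd i P \<beta> \<noteq> 0}"
    then have "i < length \<beta>" "P (\<beta>[i := Suc (\<beta> ! i)]) \<noteq> 0" by (auto simp: dpd_nonzero)
    then show "\<beta> \<in> (\<lambda>\<alpha>. \<alpha>[i := \<alpha> ! i - 1]) ` {\<alpha>. P \<alpha> \<noteq> 0}"
      by (intro image_eqI[of _ _ "\<beta>[i := Suc (\<beta> ! i)]"]) auto
  qed
  moreover have "finite {\<alpha>. P \<alpha> \<noteq> 0}" using assms by (simp add: is_dpoly_def)
  ultimately show "finite {\<beta>. dpd i P \<beta> \<noteq> 0}" by (rule finite_subset[OF _ finite_imageI])
  show "\<forall>\<beta>. dpd i P \<beta> \<noteq> 0 \<longrightarrow> length \<beta> = Suc n"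
    using assms unfolding dpd_nonzero is_dpoly_def by (metis length_list_update)
qed

lemma dpoly_supp_dpd: "dpoly_supp (dpd i P) \<subseteq> dpoly_supp P"
proof
  fix t assume "t \<in> dpoly_supp (dpd i P)"
  then obtain \<beta> k where "t = real k" "coeff (dpd i P \<beta>) k \<noteq> 0" by (auto simp: dpoly_supp_def)
  moreover from this have "coeff (P (\<beta>[i := Suc (\<beta> ! i)])) k \<noteq> 0"
    by (auto simp: dpd_def split: if_splits)
  ultimately show "t \<in> dpoly_supp P" unfolding dpoly_supp_def by blast
qed

lemma deval_dpd:
  assumes P: "is_dpoly n P" and i: "i < Suc n"
  shows "deval n (dpd i P) y = (\<Sum>\<alpha> | P \<alpha> \<noteq> 0. pg (P \<alpha>) * pd i y (exp_word (Suc n) \<alpha>))"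
proof -
  have len: "length \<alpha> = Suc n" if "P \<alpha> \<noteq> 0" for \<alpha> using P that by (simp add: is_dpoly_def)
  have "(\<Sum>\<alpha> | P \<alpha> \<noteq> 0. pg (P \<alpha>) * pd i y (exp_word (Suc n) \<alpha>)) =
      (\<Sum>\<alpha> | P \<alpha> \<noteq> 0. pg (P \<alpha>) * (of_nat (\<alpha> ! i) * mpow (Suc n) y (\<alpha>[i := \<alpha> ! i - 1])))"
    using i len by (intro sum.cong) (simp_all add: pd_exp_word)
  \<comment> \<open>Lowering place \<open>i\<close> is invertible only where the exponent is
    positive; the dropped terms carry the factor \<open>of_nat 0\<close>.\<close>
  also have "\<dots> = (\<Sum>\<alpha> | P \<alpha> \<noteq> 0 \<and> 0 < \<alpha> ! i.
      pg (P \<alpha>) * (of_nat (\<alpha> ! i) * mpow (Suc n) y (\<alpha>[i := \<alpha> ! i - 1])))"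
    using P by (intro sum.mono_neutral_right) (auto simp: is_dpoly_def intro!: Nat.gr0I)
  also have "\<dots> = (\<Sum>\<beta> | dpd i P \<beta> \<noteq> 0. pg (dpd i P \<beta>) * mpow (Suc n) y \<beta>)"
  proof (rule sum.reindex_bij_witness[of _ "\<lambda>\<beta>. \<beta>[i := Suc (\<beta> ! i)]" "\<lambda>\<alpha>. \<alpha>[i := \<alpha> ! i - 1]"])
    fix \<alpha> assume a: "\<alpha> \<in> {\<alpha>. P \<alpha> \<noteq> 0 \<and> 0 < \<alpha> ! i}"
    then have l: "i < length \<alpha>" "0 < \<alpha> ! i" using len i by auto
    show "(\<alpha>[i := \<alpha> ! i - 1])[i := Suc (\<alpha>[i := \<alpha> ! i - 1] ! i)] = \<alpha>" using l by simp
    show "\<alpha>[i := \<alpha> ! i - 1] \<in> {\<beta>. dpd i P \<beta> \<noteq> 0}" using l a by (simp add: dpd_nonzero)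
    show "pg (dpd i P (\<alpha>[i := \<alpha> ! i - 1])) * mpow (Suc n) y (\<alpha>[i := \<alpha> ! i - 1]) =
        pg (P \<alpha>) * (of_nat (\<alpha> ! i) * mpow (Suc n) y (\<alpha>[i := \<alpha> ! i - 1]))"
      unfolding dpd_lower[OF l] pg_smult_of_nat by (simp add: ac_simps)
  qed (auto simp: dpd_nonzero)
  finally show ?thesis by (simp add: deval_def)
qed

text \<open>If all partial derivatives vanish at \<open>y\<close>, a formally nonzero one is a
  polynomial of smaller total degree that still vanishes there, so the search can restart with it.
  This must end before only an element of C[x] is left.\<close>

lemma separable_descent:
  assumes "is_dpoly n P" "P \<alpha> \<noteq> 0" "deval n P y = 0"
  shows "\<exists>P' i. is_dpoly n P' \<and> deval n P' y = 0 \<and> i < Suc n \<and> deval n (dpd i P') y \<noteq> 0 \<and>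
    dpoly_supp P' \<subseteq> dpoly_supp P"
proof -
  have fin: "finite {\<alpha>. P \<alpha> \<noteq> 0}" using assms(1) by (simp add: is_dpoly_def)
  define k where "k = Max (sum_list ` {\<alpha>. P \<alpha> \<noteq> 0})"
  have "\<forall>\<alpha>. P \<alpha> \<noteq> 0 \<longrightarrow> sum_list \<alpha> \<le> k"
    unfolding k_def using fin by (auto intro: Max_ge)
  then show ?thesis using assms
  proof (induction k arbitrary: P \<alpha> rule: less_induct)
    case (less k P)
    have len: "length \<alpha> = Suc n" if "P \<alpha> \<noteq> 0" for \<alpha> using less.prems(2) that by (simp add: is_dpoly_def)
    consider (sep) i where "i < Suc n" "deval n (dpd i P) y \<noteq> 0"
      | (desc) i \<beta> where "i < Suc n" "deval n (dpd i P) y = 0" "dpd i P \<beta> \<noteq> 0"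
      | (const) "\<And>i \<beta>. i < Suc n \<Longrightarrow> dpd i P \<beta> = 0" by blast
    then show ?case
    proof cases
      case sep
      then show ?thesis using less.prems by blast
    next
      case desc
      have lt: "sum_list \<gamma> < k" if "dpd i P \<gamma> \<noteq> 0" for \<gamma>
      proof -
        have g: "i < length \<gamma>" "P (\<gamma>[i := Suc (\<gamma> ! i)]) \<noteq> 0" using that by (auto simp: dpd_nonzero)
        then have "sum_list (\<gamma>[i := Suc (\<gamma> ! i)]) \<le> k" using less.prems(1) by blast
        then show ?thesis using g(1) elem_le_sum_list[of i \<gamma>] by (simp add: sum_list_update)
      qed
      then have "k - 1 < k" "\<forall>\<alpha>. dpd i P \<alpha> \<noteq> 0 \<longrightarrow> sum_list \<alpha> \<le> k - 1" using desc(3) by fastforce+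
      from less.IH[OF this is_dpoly_dpd[OF less.prems(2)] desc(3,2)]
      show ?thesis using dpoly_supp_dpd by blast
    next
      case const
      \<comment> \<open>In characteristic 0, vanishing of all formal partial derivatives leaves the
        trivial monomial only; a nonzero element of C[x] cannot evaluate to 0.\<close>
      have zero: "\<beta> = replicate (Suc n) 0" if "P \<beta> \<noteq> 0" for \<beta>
      proof (rule nth_equalityI)
        fix i assume i: "i < length \<beta>"
        then have "dpd i P (\<beta>[i := \<beta> ! i - 1]) = 0" using const len[OF that] by simp
        then have "\<beta> ! i = 0" using dpd_lower[of i \<beta> P] i that by auto
        then show "\<beta> ! i = replicate (Suc n) 0 ! i" using i len[OF that] by (simp del: replicate_Suc)
      qed (use len[OF that] in simp)
      then have "{\<beta>. P \<beta> \<noteq> 0} = {\<alpha>}" using less.prems(3) by blast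
      then have "deval n P y = pg (P \<alpha>) * mpow (Suc n) y \<alpha>" by (simp add: deval_def)
      also have "mpow (Suc n) y \<alpha> = 1" using zero[OF less.prems(3)] by (simp add: mpow_def del: replicate_Suc)
      finally show ?thesis using pg_nonzero[OF less.prems(3)] less.prems(4) by simp
    qed
  qed
qed

section \<open>Derivations applied to the equation, and its indicial equation\<close>

lemma derivation_words_eval:
  assumes add: "\<And>a b. \<delta> (a + b) = \<delta> a + \<delta> b"
    and leibniz: "\<And>a b. \<delta> (a * b) = \<delta> a * b + a * \<delta> b"
    and Ps: "\<And>c ws. (c, ws) \<in> set Ps \<Longrightarrow> \<delta> c = 0 \<and> set ws \<subseteq> {..<N}"
  shows "\<delta> (words_eval Ps y) = (\<Sum>i<N. words_pd Ps i y * \<delta> (y i))"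
proof -
  have d1: "\<delta> 1 = (0 :: gs)" using leibniz[of 1 1] by simp
  have d0: "\<delta> 0 = (0 :: gs)" using add[of 0 0] by simp
  have word: "\<delta> (wprod y ws) = (\<Sum>i<N. pd i y ws * \<delta> (y i))" if "set ws \<subseteq> {..<N}" for ws
    using that
  proof (induction ws)
    case (Cons j ws)
    have "pd i y (j # ws) * \<delta> (y i) = (if i = j then wprod y ws * \<delta> (y j) else 0) + y j * (pd i y ws * \<delta> (y i))" for i
      by (simp add: algebra_simps)
    then have "(\<Sum>i<N. pd i y (j # ws) * \<delta> (y i)) =
        (\<Sum>i<N. (if i = j then wprod y ws * \<delta> (y j) else 0) + y j * (pd i y ws * \<delta> (y i)))" by presburger
    also have "\<dots> = wprod y ws * \<delta> (y j) + y j * (\<Sum>i<N. pd i y ws * \<delta> (y i))"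
      using Cons.prems by (simp only: sum.distrib sum_distrib_left) simp
    also have "\<dots> = \<delta> (wprod y (j # ws))" using Cons by (simp add: leibniz mult.commute)
    finally show ?case by simp
  qed (simp add: d1)
  show ?thesis using Ps
  proof (induction Ps)
    case (Cons x Ps)
    obtain c ws where x: "x = (c, ws)" by fastforce
    have "\<delta> c = 0" "set ws \<subseteq> {..<N}" using Cons.prems[of c ws] x by auto
    then have "\<delta> (c * wprod y ws) = c * (\<Sum>i<N. pd i y ws * \<delta> (y i))" by (simp add: leibniz word)
    moreover have "\<delta> (words_eval Ps y) = (\<Sum>i<N. words_pd Ps i y * \<delta> (y i))"
      using Cons.IH Cons.prems by force
    ultimately show ?case
      by (simp add: words_eval_def words_pd_def x add sum_distrib_left sum.distrib distrib_right mult.assoc)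
  qed (simp add: words_eval_def words_pd_def d0)
qed

text \<open>Applying \<open>\<delta>\<close> gives a linear equation for \<open>\<delta> s\<close>
  with coefficients \<open>A i\<close>. Its coefficient at \<open>v + \<rho>\<close>, the lowest
  exponent possible, is the indicial sum at \<open>\<rho>\<close> times the leading coefficient of
  \<open>\<delta> s\<close>.\<close>

lemma indicial_root:
  assumes Ps: "\<And>c ws. (c, ws) \<in> set Ps \<Longrightarrow> \<delta> c = 0 \<and> set ws \<subseteq> {..<N}"
    and zero: "words_eval Ps (shiftop d \<phi> s) = 0"
    and add: "\<And>a b. \<delta> (a + b) = \<delta> a + \<delta> b"
    and leibniz: "\<And>a b. \<delta> (a * b) = \<delta> a * b + a * \<delta> b"
    and comm: "\<And>i. i < N \<Longrightarrow> \<delta> (shiftop d \<phi> s i) = shiftop d \<phi> (\<delta> s) i"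
    and A: "\<And>i. A i = mon (- d i) * words_pd Ps i (shiftop d \<phi> s)"
    and lowA: "\<And>i. i < N \<Longrightarrow> lowb v (A i)"
    and low: "lowb \<rho> (\<delta> s)" "gcoeff (\<delta> s) \<rho> \<noteq> 0"
  shows "(\<Sum>i<N. gcoeff (A i) v * \<phi> i \<rho>) = 0"
proof -
  have "\<delta> 0 = 0" using add[of 0 0] by simp
  then have "0 = (\<Sum>i<N. words_pd Ps i (shiftop d \<phi> s) * \<delta> (shiftop d \<phi> s i))"
    using derivation_words_eval[of \<delta> Ps N, OF add leibniz Ps] zero by metis
  also have "\<dots> = (\<Sum>i<N. A i * diag (\<phi> i) (\<delta> s))"
    using comm by (intro sum.cong) (simp_all add: A shiftop_def ac_simps)
  finally have "0 = gcoeff (\<Sum>i<N. A i * diag (\<phi> i) (\<delta> s)) (v + \<rho>)" by simp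
  also have "\<dots> = (\<Sum>i<N. gcoeff (A i) v * (\<phi> i \<rho> * gcoeff (\<delta> s) \<rho>))"
    unfolding gcoeff_sum
    using lowA low(1) by (intro sum.cong refl) (simp add: gcoeff_mult_lowest lowb_diag)
  also have "\<dots> = (\<Sum>i<N. gcoeff (A i) v * \<phi> i \<rho>) * gcoeff (\<delta> s) \<rho>"
    by (simp add: sum_distrib_right mult.assoc)
  finally show ?thesis using low(2) by simp
qed

lemma common_lowest:
  fixes A :: "nat \<Rightarrow> gs"
  assumes "i < N" "A i \<noteq> 0"
  obtains v j where "\<And>i. i < N \<Longrightarrow> lowb v (A i)" "j < N" "gcoeff (A j) v \<noteq> 0"
proof -
  obtain t where t: "gcoeff (A i) t \<noteq> 0" using assms(2) gs_eqI[of "A i" 0] by auto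
  \<comment> \<open>Cutting at an exponent \<open>t\<close> that does occur makes the set finite
    without changing the minimum over all \<open>A i\<close>.\<close>
  let ?S = "\<Union>i<N. {\<mu>. \<mu> \<le> t \<and> gcoeff (A i) \<mu> \<noteq> 0}"
  have S: "finite ?S" "t \<in> ?S" using t assms(1) by (auto simp: finite_gcoeff)
  define v where "v = Min ?S"
  have "v \<in> ?S" unfolding v_def using S by (intro Min_in) auto
  moreover have "lowb v (A j)" if "j < N" for j
    unfolding lowb_def
  proof (intro allI impI)
    fix \<mu> assume \<mu>: "gcoeff (A j) \<mu> \<noteq> 0"
    have "v \<le> t" unfolding v_def using S by (intro Min_le) auto
    moreover have "v \<le> \<mu>" if "\<mu> \<le> t"
      unfolding v_def using S \<mu> that \<open>j < N\<close> by (intro Min_le) auto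
    ultimately show "v \<le> \<mu>" by linarith
  qed
  ultimately show ?thesis using that by blast
qed

section \<open>Roots of the indicial equation\<close>

lemma of_nat_in_span: "real k \<in> Q.span {1}"
  using Q.span_scale[OF Q.span_base[of 1 "{1}"], of "of_nat k"] by simp

lemma span_dpoly_supp:
  assumes "\<not> dpoly_supp P \<subseteq> {0}"
  shows "Q.span (dpoly_supp P) = Q.span {1}"
proof
  have "dpoly_supp P \<subseteq> Q.span {1}" using of_nat_in_span by (auto simp: dpoly_supp_def)
  then show "Q.span (dpoly_supp P) \<subseteq> Q.span {1}" by (rule Q.span_minimal[OF _ Q.subspace_span])
  obtain t where t: "t \<in> dpoly_supp P" "t \<noteq> 0" using assms by blast
  then obtain k where "t = real k" by (auto simp: dpoly_supp_def)
  with t have k: "real k \<in> dpoly_supp P" "real k \<noteq> 0" by auto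
  have "of_rat (1 / of_nat k) * real k \<in> Q.span (dpoly_supp P)" by (intro Q.span_scale Q.span_base k(1))
  also have "of_rat (1 / of_nat k) * real k = 1" using k(2) by (simp add: of_rat_divide)
  finally show "Q.span {1} \<subseteq> Q.span (dpoly_supp P)"
    by (intro Q.span_minimal[OF _ Q.subspace_span]) auto
qed

text \<open>A functional with value 1 at \<open>b\<close> that kills \<open>U\<close> and the
  smaller exponents of \<open>s\<close> makes \<open>b\<close> the leading exponent of
  \<open>\<delta> s\<close>. Killing \<open>U\<close> serves twice: \<open>\<delta>\<close>
  annihilates the coefficients, and it commutes with the shifts \<open>d i\<close>.\<close>

lemma jump_root:
  assumes b: "b \<in> jumps U (gsupp (gcoeff s))"
    and Ps: "\<And>c ws. (c, ws) \<in> set Ps \<Longrightarrow> gsupp (gcoeff c) \<subseteq> Q.span U \<and> set ws \<subseteq> {..<N}"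
    and zero: "words_eval Ps (shiftop d \<phi> s) = 0"
    and d: "\<And>i. i < N \<Longrightarrow> d i \<in> Q.span U"
    and A: "\<And>i. A i = mon (- d i) * words_pd Ps i (shiftop d \<phi> s)"
    and lowA: "\<And>i. i < N \<Longrightarrow> lowb v (A i)"
  shows "(\<Sum>i<N. gcoeff (A i) v * \<phi> i b) = 0"
proof -
  let ?X = "U \<union> {\<mu> \<in> gsupp (gcoeff s). \<mu> < b}"
  have "b \<notin> Q.span ?X" using b by (simp add: jumps_def)
  then obtain l :: "real \<Rightarrow> real" where l: "\<And>u v. l (u + v) = l u + l v" "\<And>x. x \<in> Q.span ?X \<Longrightarrow> l x = 0" "l b = 1"
    by (rule rational_functional) blast
  have lU: "l x = 0" if "x \<in> Q.span U" for x using l(2) that Q.span_mono[of U ?X] by blast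
  have ls: "l \<mu> = 0" if "gcoeff s \<mu> \<noteq> 0" "\<mu> < b" for \<mu>
    using that by (intro l(2) Q.span_base) (simp add: gsupp_def)
  define \<delta> where "\<delta> = diag (\<lambda>\<mu>. of_real (l \<mu>))"
  show ?thesis
  proof (rule indicial_root[where \<delta> = \<delta> and Ps = Ps and d = d and s = s, OF _ zero _ _ _ A lowA])
    show "\<delta> c = 0 \<and> set ws \<subseteq> {..<N}" if "(c, ws) \<in> set Ps" for c ws
    proof
      show "\<delta> c = 0"
      proof (rule gs_eqI)
        fix t show "gcoeff (\<delta> c) t = gcoeff 0 t"
          using lU[of t] Ps[OF that] by (auto simp: \<delta>_def gsupp_def)
      qed
    qed (use Ps[OF that] in blast)
    show "\<delta> (a + a') = \<delta> a + \<delta> a'" for a a' by (simp add: \<delta>_def diag_add)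
    show "\<delta> (a * a') = \<delta> a * a' + a * \<delta> a'" for a a' by (simp add: \<delta>_def diag_mult l(1))
    show "\<delta> (shiftop d \<phi> s i) = shiftop d \<phi> (\<delta> s) i" if "i < N" for i
    proof (rule gs_eqI)
      fix t
      have "l (t + d i) = l t" using l(1) lU[OF d[OF that]] by simp
      then show "gcoeff (\<delta> (shiftop d \<phi> s i)) t = gcoeff (shiftop d \<phi> (\<delta> s) i) t"
        by (simp add: \<delta>_def shiftop_def)
    qed
    show "lowb b (\<delta> s)" unfolding lowb_def \<delta>_def using ls by fastforce
    show "gcoeff (\<delta> s) b \<noteq> 0" using b l(3) by (simp add: \<delta>_def jumps_def gsupp_def)
  qed auto
qed

text \<open>For an autonomous equation \<open>P(y, y', \<dots>) = 0\<close> the rational functionals must kill \<open>1\<close> to commute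
  with \<open>d/dx\<close>, which may cost one solution of the linearized equation; translation invariance supplies
  \<open>s'\<close> instead, whose leading exponent lies strictly below all jumps.\<close>
lemma translation_root:
  assumes Ps: "\<And>c ws. (c, ws) \<in> set Ps \<Longrightarrow> gsupp (gcoeff c) \<subseteq> {0} \<and> set ws \<subseteq> {..<N}"
    and zero: "words_eval Ps (shiftop (shft Deriv) (symb Deriv) s) = 0"
    and A: "\<And>i. A i = mon (- shft Deriv i) * words_pd Ps i (shiftop (shft Deriv) (symb Deriv) s)"
    and lowA: "\<And>i. i < N \<Longrightarrow> lowb v (A i)"
    and \<mu>0: "gcoeff s \<mu>0 \<noteq> 0" "\<mu>0 \<noteq> 0" "\<And>\<mu>. gcoeff s \<mu> \<noteq> 0 \<Longrightarrow> \<mu> \<noteq> 0 \<Longrightarrow> \<mu>0 \<le> \<mu>"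
  shows "(\<Sum>i<N. gcoeff (A i) v * symb Deriv i (\<mu>0 - 1)) = 0"
proof -
  define \<delta> where "\<delta> a = mon (- 1) * diag of_real a" for a
  have \<delta>: "gcoeff (\<delta> a) = apply_oper Deriv (gcoeff a)" for a
    by (simp add: \<delta>_def fun_eq_iff)
  show ?thesis
  proof (rule indicial_root[where \<delta> = \<delta> and Ps = Ps and d = "shft Deriv" and s = s, OF _ zero _ _ _ A lowA])
    show "\<delta> c = 0 \<and> set ws \<subseteq> {..<N}" if "(c, ws) \<in> set Ps" for c ws
    proof
      show "\<delta> c = 0"
      proof (rule gs_eqI)
        fix t
        have "gcoeff c (t + 1) = 0 \<or> t + 1 = 0" using Ps[OF that] by (auto simp: gsupp_def)
        then show "gcoeff (\<delta> c) t = gcoeff 0 t" by (auto simp: \<delta>_def simp del: of_real_add)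
      qed
    qed (use Ps[OF that] in blast)
    show "\<delta> (a + a') = \<delta> a + \<delta> a'" for a a' by (simp add: \<delta>_def diag_add distrib_left)
    show "\<delta> (a * a') = \<delta> a * a' + a * \<delta> a'" for a a'
      by (simp add: \<delta>_def diag_mult distrib_left mult.assoc mult.left_commute)
    show "\<delta> (shiftop (shft Deriv) (symb Deriv) s i) = shiftop (shft Deriv) (symb Deriv) (\<delta> s) i" if "i < N" for i
    proof (rule gs_eqI)
      fix t
      \<comment> \<open>By \<open>apply_oper_funpow\<close> both sides are iterates of one operator
        on \<open>s\<close>.\<close>
      show "gcoeff (\<delta> (shiftop (shft Deriv) (symb Deriv) s i)) t = gcoeff (shiftop (shft Deriv) (symb Deriv) (\<delta> s) i) t"
        unfolding \<delta> apply_oper_funpow[symmetric] by (simp only: funpow_swap1)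
    qed
    \<comment> \<open>Differentiation removes a constant term of \<open>s\<close>, hence the leading
      exponent stems from the least nonzero one.\<close>
    show "lowb (\<mu>0 - 1) (\<delta> s)"
      unfolding lowb_def
    proof (intro allI impI)
      fix t assume "gcoeff (\<delta> s) t \<noteq> 0"
      then have "gcoeff s (t + 1) \<noteq> 0" "t + 1 \<noteq> 0"
        by (auto simp: \<delta>_def simp del: of_real_add)
      then show "\<mu>0 - 1 \<le> t" using \<mu>0(3)[of "t + 1"] by simp
    qed
    show "gcoeff (\<delta> s) (\<mu>0 - 1) \<noteq> 0" using \<mu>0 by (simp add: \<delta>_def)
  qed auto
qed

lemma finite_gsupp_le: "finite {\<mu> \<in> gsupp (gcoeff s). \<mu> \<le> t}"
  using finite_gcoeff[of t s] by (rule rev_finite_subset) (auto simp: gsupp_def)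

text \<open>Jumps are roots; the cases differ in how the loss \<open>card U\<close> is recovered. If
  \<open>P\<close> has a nonzero exponent, \<open>U = {1}\<close> and 1 can be adjoined to
  \<open>B\<close>. Otherwise \<open>U\<close> is empty for the Euler and q-difference operators,
  while for d/dx the shifts force \<open>U = {1}\<close> and \<open>translation_root\<close>
  supplies one more root. Finiteness is a hypothesis because \<open>card\<close> is 0 on infinite
  sets.\<close>

lemma indicial_roots_card:
  fixes s :: gs
  assumes Ps: "\<And>c ws. (c, ws) \<in> set Ps \<Longrightarrow> gsupp (gcoeff c) \<subseteq> dpoly_supp P \<and> set ws \<subseteq> {..<N}"
    and zero: "words_eval Ps (shiftop (shft D) (symb D) s) = 0"
    and A: "\<And>i. A i = mon (- shft D i) * words_pd Ps i (shiftop (shft D) (symb D) s)"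
    and lowA: "\<And>i. i < N \<Longrightarrow> lowb v (A i)"
    and p: "\<And>\<mu>. p \<mu> = (\<Sum>i<N. gcoeff (A i) v * symb D i \<mu>)"
    and B: "B \<subseteq> gsupp (gcoeff s) \<union> dpoly_supp P" "finite B" "indep_mod (rat_span (dpoly_supp P)) B"
    and fin: "finite {\<rho>. p \<rho> = 0}"
  shows "card B \<le> card {\<rho>. p \<rho> = 0}"
proof -
  let ?W = "dpoly_supp P" and ?S = "gsupp (gcoeff s)"
  have jumps_le: "jumps U ?S \<subseteq> {\<rho>. p \<rho> = 0}" "finite (jumps U ?S)"
    if "?W \<subseteq> Q.span U" "\<And>i. shft D i \<in> Q.span U" for U
  proof -
    show "jumps U ?S \<subseteq> {\<rho>. p \<rho> = 0}"
    proof
      fix b assume b: "b \<in> jumps U ?S"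
      have "p b = 0" unfolding p
        by (rule jump_root[OF b _ zero that(2) A lowA]) (use Ps that(1) in blast)+
      then show "b \<in> {\<rho>. p \<rho> = 0}" by simp
    qed
    then show "finite (jumps U ?S)" using fin finite_subset by blast
  qed
  have W1: "?W \<subseteq> Q.span {1}" using of_nat_in_span by (auto simp: dpoly_supp_def)
  have d1: "shft D i \<in> Q.span {1}" for i
    using of_nat_in_span Q.span_zero by (cases D) auto
  note jumps1 = jumps_le[OF W1 d1]
  show ?thesis
  proof (cases "?W \<subseteq> {0}")
    case False
    then have B1: "indep_mod (Q.span {1}) B" using B(3) by (simp add: rat_span_eq span_dpoly_supp)
    have "card (insert 1 B) \<le> card {1::real} + card (jumps {1} ?S)"
      using B W1 by (intro card_le_jumps finite_gsupp_le jumps1 indep_mod_insert[OF B(2) B1])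
        (auto intro: Q.span_base)
    then have "card B \<le> card (jumps {1} ?S)" using B(2) indep_mod_insert(2)[OF B(2) B1] by simp
    then show ?thesis using card_mono[OF fin jumps1(1)] by linarith
  next
    case True
    have ind: "Q.independent B"
      using indep_mod_independent[OF B(2,3)] Q.span_zero by (simp add: rat_span_eq)
    show ?thesis
    proof (cases "D = Deriv")
      case False
      have W0: "?W \<subseteq> Q.span {}" using True by simp
      have d0: "shft D i \<in> Q.span {}" for i using False by (cases D) auto
      have "card B \<le> card ({} :: real set) + card (jumps {} ?S)"
        using B W0 by (intro card_le_jumps finite_gsupp_le jumps_le[OF W0 d0] ind) auto
      then show ?thesis using card_mono[OF fin jumps_le(1)[OF W0 d0]] by simp
    next
      case D: True
      show ?thesis
      proof (cases "B = {}")
        case False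
        then obtain b where b: "b \<in> B" by blast
        \<comment> \<open>This guarantees a nonzero exponent in \<open>s\<close>, so that its
          derivative has a leading term.\<close>
        then have "b \<noteq> 0" using ind Q.dependent_zero by blast
        then have bS: "b \<in> ?S" using b B(1) True by blast
        let ?M = "{\<mu> \<in> ?S. \<mu> \<le> b} - {0}"
        have M: "finite ?M" "b \<in> ?M" using finite_gsupp_le bS \<open>b \<noteq> 0\<close> by auto
        define \<mu>0 where "\<mu>0 = Min ?M"
        have "\<mu>0 \<in> ?M" unfolding \<mu>0_def using M by (intro Min_in) auto
        then have \<mu>0: "gcoeff s \<mu>0 \<noteq> 0" "\<mu>0 \<noteq> 0" by (auto simp: gsupp_def)
        have least: "\<mu>0 \<le> \<mu>" if "gcoeff s \<mu> \<noteq> 0" "\<mu> \<noteq> 0" for \<mu>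
        proof (cases "\<mu> \<le> b")
          case True
          then show ?thesis unfolding \<mu>0_def using M that by (intro Min_le) (auto simp: gsupp_def)
        next
          case False
          moreover have "\<mu>0 \<le> b" unfolding \<mu>0_def using M by (intro Min_le)
          ultimately show ?thesis by linarith
        qed
        have "p (\<mu>0 - 1) = 0"
          unfolding p D
          by (rule translation_root[OF _ zero[unfolded D] A[unfolded D] lowA \<mu>0 least]) (use Ps True in blast)+
        \<comment> \<open>A jump is an exponent of \<open>s\<close> outside the span of 1, hence
          nonzero and at least \<open>\<mu>0\<close>. The translation root is therefore new.\<close>
        moreover have "\<mu>0 - 1 \<notin> jumps {1} ?S"
        proof
          assume *: "\<mu>0 - 1 \<in> jumps {1} ?S"
          then have "\<mu>0 - 1 \<noteq> 0" using Q.span_zero by (auto simp: jumps_def)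
          then show False using * least[of "\<mu>0 - 1"] by (auto simp: jumps_def gsupp_def)
        qed
        ultimately have "Suc (card (jumps {1} ?S)) \<le> card {\<rho>. p \<rho> = 0}"
          using card_mono[OF fin, of "insert (\<mu>0 - 1) (jumps {1} ?S)"] jumps1 by simp
        moreover have "card B \<le> card {1::real} + card (jumps {1} ?S)"
          using B W1 by (intro card_le_jumps finite_gsupp_le jumps1 ind) auto
        ultimately show ?thesis by simp
      qed simp
    qed
  qed
qed

theorem theorem2:
  fixes D :: oper and n :: nat and P :: "nat list \<Rightarrow> complex poly" and s :: gser
  assumes "valid_oper D"
    and "is_dpoly n P"
    and "\<exists>\<alpha>. P \<alpha> \<noteq> 0"
    and "is_gser s"
    and "eval_dpoly D n P s = gzero"
    and "quot_rank_eq (gsupp s \<union> dpoly_supp P) (dpoly_supp P) n"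
  shows "\<forall>\<theta>0 \<beta>. 0 < \<beta> \<and> \<beta> < 2 * pi \<longrightarrow>
           (\<exists>\<rho>>0. \<exists>f. uniform_limit (sector \<rho> \<theta>0 \<beta>) (gpartial s) f at_top)"
proof -
  define S where "S = Gs s"
  have s: "s = gcoeff S" unfolding S_def using assms(4) by (simp add: Gs_inverse)
  define y where "y = shiftop (shft D) (symb D) S"
  have "gcoeff (deval n P y) = gcoeff 0"
    using assms(5) unfolding s eval_dpoly_gcoeff y_def by (simp add: zero_gs.rep_eq)
  then have "deval n P y = 0" by (simp only: gcoeff_inject)
  then obtain P' i0 where P': "is_dpoly n P'" "deval n P' y = 0" "i0 < Suc n"
      "deval n (dpd i0 P') y \<noteq> 0" "dpoly_supp P' \<subseteq> dpoly_supp P"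
    using separable_descent assms(2,3) by blast
  obtain \<alpha>s where \<alpha>s: "set \<alpha>s = {\<alpha>. P' \<alpha> \<noteq> 0}" "distinct \<alpha>s"
    using finite_distinct_list P'(1) unfolding is_dpoly_def by blast
  define Ps where "Ps = map (\<lambda>\<alpha>. (pg (P' \<alpha>), exp_word (Suc n) \<alpha>)) \<alpha>s"
  have Ps: "fin c \<and> lowb 0 c \<and> set ws \<subseteq> {..<Suc n} \<and> gsupp (gcoeff c) \<subseteq> dpoly_supp P"
    if cw: "(c, ws) \<in> set Ps" for c ws
  proof -
    obtain \<alpha> where \<alpha>: "c = pg (P' \<alpha>)" "ws = exp_word (Suc n) \<alpha>" using cw by (auto simp: Ps_def)
    have "gsupp (gcoeff c) \<subseteq> dpoly_supp P'"
      unfolding \<alpha> gsupp_def dpoly_supp_def using gcoeff_pg_nonzeroD by blast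
    then show ?thesis using fin_pg lowb_pg set_exp_word P'(5) unfolding \<alpha> by blast
  qed
  have sum_Ps: "(\<Sum>\<alpha>\<leftarrow>\<alpha>s. h \<alpha>) = (\<Sum>\<alpha> | P' \<alpha> \<noteq> 0. h \<alpha>)" for h :: "nat list \<Rightarrow> gs"
    using sum.distinct_set_conv_list[OF \<alpha>s(2), of h] \<alpha>s(1) by simp
  have zero: "words_eval Ps y = 0"
    using P'(2) by (simp add: words_eval_def Ps_def comp_def wprod_exp_word sum_Ps deval_def)
  have pd: "words_pd Ps i y = deval n (dpd i P') y" if "i < Suc n" for i
    by (simp add: words_pd_def Ps_def comp_def sum_Ps deval_dpd[OF P'(1) that])
  define A where "A i = mon (- shft D i) * words_pd Ps i y" for i
  have "A i0 \<noteq> 0"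
  proof
    assume "A i0 = 0"
    then have "mon (shft D i0) * A i0 = 0" by simp
    then have "words_pd Ps i0 y = 0" unfolding A_def mon_mult_assoc by (simp add: mon_0)
    then show False using P'(3,4) pd by simp
  qed
  \<comment> \<open>The common lowest order of the linearized operator, shifts included. That some
    \<open>A j\<close> attains it makes the indicial polynomial nonzero.\<close>
  then obtain v j where v: "\<And>i. i < Suc n \<Longrightarrow> lowb v (A i)" "j < Suc n" "gcoeff (A j) v \<noteq> 0"
    using common_lowest[OF P'(3)] by blast
  define p where "p \<mu> = (\<Sum>i<Suc n. gcoeff (A i) v * symb D i \<mu>)" for \<mu>
  have A': "A i = mon (- shft D i) * words_pd Ps i (shiftop (shft D) (symb D) S)" for i
    by (simp only: A_def y_def)
  note zero' = zero[unfolded y_def]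
  obtain B where B: "B \<subseteq> gsupp (gcoeff S) \<union> dpoly_supp P" "finite B" "card B = n"
      "indep_mod (rat_span (dpoly_supp P)) B"
    using assms(6) unfolding quot_rank_eq_def s by blast
  have roots: "n \<le> card {\<rho>. p \<rho> = 0}" if "finite {\<rho>. p \<rho> = 0}"
    using indicial_roots_card[OF _ zero' A' v(1) p_def B(1,2,4) that] Ps B(3) by blast
  obtain C T0 where C: "0 \<le> C" "\<forall>\<mu>>T0. \<forall>i<Suc n. cmod (symb D i \<mu>) \<le> C * cmod (p \<mu>)"
    using symbols_dominated[OF assms(1) p_def v(2,3) roots] by blast
  have "\<exists>r T. 0 < r \<and> r < 1 \<and> 0 \<le> T \<and>
      (\<forall>U. finite U \<and> U \<subseteq> {T<..} \<longrightarrow> (\<Sum>\<mu>\<in>U. cmod (gcoeff S \<mu>) * r powr \<mu>) \<le> C)"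
  proof (rule regular_singular_convergence[where Ps = Ps and d = "shft D" and \<phi> = "symb D" and p = p,
        OF _ zero' _ A' v(1) p_def C(1)])
    show "fin c \<and> lowb 0 c \<and> set ws \<subseteq> {..<Suc n}" if "(c, ws) \<in> set Ps" for c ws
      using Ps[OF that] by blast
    show "0 \<le> shft D i" for i by (rule shft_nonneg)
    show "cmod (symb D i \<mu>) \<le> C * cmod (p \<mu>)" if "T0 < \<mu>" "i < Suc n" for \<mu> i
      using C(2) that by blast
    \<comment> \<open>The symbol of index 0 is 1, so its bound keeps \<open>p\<close> away from
      0.\<close>
    show "1 \<le> C * cmod (p \<mu>)" if "T0 < \<mu>" for \<mu>
      using C(2)[rule_format, OF that, of 0] by (simp add: symb_0)
  qed
  then obtain r T where rT: "0 < r" "0 \<le> T"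
      "\<And>U. finite U \<Longrightarrow> U \<subseteq> {T<..} \<Longrightarrow> (\<Sum>\<mu>\<in>U. cmod (s \<mu>) * r powr \<mu>) \<le> C"
    unfolding s by blast
  show ?thesis
    using uniform_limit_gpartial[OF assms(4) rT(2,3)] rT(1) by blast
qed

end
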